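(* Let $q_\ell:\mathbb{R}^d\times\mathbb{R}\to\mathbb{C}$ ($\ell=1,\dots,d$) and $a_\alpha:\mathbb{R}^d\times\mathbb{R}\to\mathbb{R}$ ($\alpha=0,\dots,d$) be a smooth solution of $$\begin{aligned}&\mathcal{D}_tq_\ell=i\mathcal{D}_k^2q_\ell+\langle q_\ell,iq_k\rangle q_k,\\ &\mathcal{D}_\ell q_k=\mathcal{D}_kq_\ell,\\ &\partial_\ell a_j-\partial_ja_\ell=-\langle q_\ell,iq_j\rangle,\\ &\partial_\ell a_0-\partial_ta_\ell=-\langle q_\ell,iq_0\rangle,\\ &\partial_ka_k=0,\end{aligned}$$ where $q_0=i\mathcal{D}_jq_j$. Let $m\in\mathbb{H}^2$ and $v_0\in T_m\mathbb{H}^2$ with $\|v_0\|=1$. Then there exist a unique smooth solution $u$ of the Schrödinger map equation $$\partial_tu=\eta\,\partial_\ell(u\times\partial_\ell u),\qquad u\in\mathbb{H}^2\subset(\mathbb{R}^3,\eta),$$ and a frame $\{e,Je\}$ for $u^{-1}T\mathbb{H}^2$ such that $u(0,0)=m$, $e(0,0)=v_0$, and $$\partial_\alpha u=q_\alpha\cdot e,\qquad D_\alpha e=a_\alpha Je,\qquad \alpha=0,1,\dots,d .$$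
   Context: Repeated Roman indices are summed over $1,\dots,d$; index $0$ denotes time $t$. $\mathcal{D}_\alpha=\partial_\alpha+ia_\alpha$ (with $\mathcal{D}_t=\mathcal{D}_0$); for $z,w\in\mathbb{C}$, $\langle z,w\rangle=\mathrm{Re}(z\bar w)$. Hyperbolic plane: $\eta=\mathrm{diag}(-1,1,1)$ on $\mathbb{R}^3$ with coordinates $(u_0,u_1,u_2)$, and $\mathbb{H}^2=\{u\in\mathbb{R}^3:-u_0^2+u_1^2+u_2^2=-1,\ u_0>0\}$, with $T_u\mathbb{H}^2=\{v\in\mathbb{R}^3:\langle\eta u,v\rangle=0\}$ ($\langle\cdot,\cdot\rangle$ the Euclidean inner product on $\mathbb{R}^3$) and $\|v\|^2=\langle v,\eta v\rangle=-v_0^2+v_1^2+v_2^2$ for $v\in T_u\mathbb{H}^2$. The complex structure is $Jv=\eta(u\times v)$, $\times$ being the usual cross product on $\mathbb{R}^3$. The covariant derivative on $u^{-1}T\mathbb{H}^2$ is $D_\alpha V=\partial_\alpha V-\langle V,\eta\,\partial_\alpha u\rangle u$. A frame $\{e,Je\}$ for $u^{-1}T\mathbb{H}^2$ means $e\in T_u\mathbb{H}^2$ with $\|e\|=1$; for $w=w_1+iw_2\in\mathbb{C}$, $w\cdot e=w_1e+w_2Je$. Functions are evaluated as $u(t,x)$. *)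

theory Defs
  imports "HOL-Analysis.Analysis"
begin

section \<open>Calculus on space-time\<close>

text \<open>Space-time points are pairs \<open>(t, x)\<close>. An index \<open>\<alpha> \<in> {0, 1, ..., d}\<close> is an element of
  \<^typ>\<open>'d option\<close>, where \<^const>\<open>None\<close> stands for the time index \<open>0\<close> and \<open>d = CARD('d)\<close>.\<close>

type_synonym 'd spacetime = "real \<times> (real ^ 'd)"

definition dir :: "'d::finite option \<Rightarrow> 'd spacetime" where
  "dir \<alpha> = (case \<alpha> of None \<Rightarrow> (1, 0) | Some k \<Rightarrow> (0, axis k 1))"

definition partial :: "'d::finite option \<Rightarrow> ('d spacetime \<Rightarrow> 'b::real_normed_vector) \<Rightarrow> 'd spacetime \<Rightarrow> 'b"
  where "partial \<alpha> f z = vector_derivative (\<lambda>s. f (z + s *\<^sub>R dir \<alpha>)) (at 0)"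

primrec times_differentiable ::
    "nat \<Rightarrow> ('a::euclidean_space \<Rightarrow> 'b::real_normed_vector) \<Rightarrow> bool" where
  "times_differentiable 0 f \<longleftrightarrow> continuous_on UNIV f"
| "times_differentiable (Suc n) f \<longleftrightarrow> (\<forall>z. f differentiable (at z)) \<and>
     (\<forall>v. times_differentiable n (\<lambda>z. frechet_derivative f (at z) v))"

definition smooth :: "('a::euclidean_space \<Rightarrow> 'b::real_normed_vector) \<Rightarrow> bool" where
  "smooth f \<longleftrightarrow> (\<forall>n. times_differentiable n f)"


section \<open>Gauge-covariant derivatives of complex fields\<close>

text \<open>The real pairing \<open>\<langle>z, w\<rangle> = Re (z \<cdot> cnj w)\<close> is the library's inner product on \<^typ>\<open>complex\<close>.\<close>

lemma inner_complex_eq_Re_cnj: "z \<bullet> w = Re (z * cnj w)"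
  by (simp add: inner_complex_def)

definition gauge_deriv :: "('d::finite option \<Rightarrow> 'd spacetime \<Rightarrow> real) \<Rightarrow> 'd option \<Rightarrow>
    ('d spacetime \<Rightarrow> complex) \<Rightarrow> 'd spacetime \<Rightarrow> complex" where
  "gauge_deriv a \<alpha> f z = partial \<alpha> f z + \<i> * of_real (a \<alpha> z) * f z"

text \<open>Extends the spatial fields \<open>q\<^sub>1, ..., q\<^sub>d\<close> by the time component \<open>q\<^sub>0 = \<i> D\<^sub>j q\<^sub>j\<close>.\<close>

definition with_time :: "('d::finite option \<Rightarrow> 'd spacetime \<Rightarrow> real) \<Rightarrow>
    ('d \<Rightarrow> 'd spacetime \<Rightarrow> complex) \<Rightarrow> 'd option \<Rightarrow> 'd spacetime \<Rightarrow> complex" where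
  "with_time a q \<alpha> = (case \<alpha> of None \<Rightarrow> (\<lambda>z. \<i> * (\<Sum>j\<in>UNIV. gauge_deriv a (Some j) (q j) z))
     | Some l \<Rightarrow> q l)"


section \<open>The hyperbolic plane in Minkowski space\<close>

text \<open>The coordinates \<open>(u\<^sub>0, u\<^sub>1, u\<^sub>2)\<close> are the components \<open>1, 2, 3\<close> of \<^typ>\<open>real^3\<close>.\<close>

definition eta :: "real^3 \<Rightarrow> real^3" where
  "eta v = vector [- (v$1), v$2, v$3]"

definition hyperbolic_plane :: "(real^3) set" where
  "hyperbolic_plane = {u. - (u$1)\<^sup>2 + (u$2)\<^sup>2 + (u$3)\<^sup>2 = -1 \<and> u$1 > 0}"

definition tangent_plane :: "real^3 \<Rightarrow> (real^3) set" where
  "tangent_plane u = {v. eta u \<bullet> v = 0}"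

definition hnorm :: "real^3 \<Rightarrow> real" where
  "hnorm v = sqrt (v \<bullet> eta v)"

definition J :: "real^3 \<Rightarrow> real^3 \<Rightarrow> real^3" where
  "J u v = eta (cross3 u v)"

text \<open>\<open>frame_mult u w e\<close> is \<open>w \<cdot> e = w\<^sub>1 e + w\<^sub>2 J e\<close> at the base point \<open>u\<close>.\<close>

definition frame_mult :: "real^3 \<Rightarrow> complex \<Rightarrow> real^3 \<Rightarrow> real^3" where
  "frame_mult u w e = Re w *\<^sub>R e + Im w *\<^sub>R J u e"

definition pullback_deriv :: "('d::finite spacetime \<Rightarrow> real^3) \<Rightarrow> 'd option \<Rightarrow>
    ('d spacetime \<Rightarrow> real^3) \<Rightarrow> 'd spacetime \<Rightarrow> real^3" where
  "pullback_deriv u \<alpha> V z = partial \<alpha> V z - (V z \<bullet> eta (partial \<alpha> u z)) *\<^sub>R u z"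

text \<open>The second member \<open>J e\<close> of a frame \<open>{e, J e}\<close> is determined by \<open>e\<close>, so a frame is given by a
  smooth unit section \<open>e\<close> of the pull-back bundle.\<close>

definition frame_along :: "('d::finite spacetime \<Rightarrow> real^3) \<Rightarrow> ('d spacetime \<Rightarrow> real^3) \<Rightarrow> bool" where
  "frame_along u e \<longleftrightarrow> smooth e \<and> (\<forall>z. e z \<in> tangent_plane (u z) \<and> hnorm (e z) = 1)"

definition schroedinger_map :: "('d::finite spacetime \<Rightarrow> real^3) \<Rightarrow> bool" where
  "schroedinger_map u \<longleftrightarrow> smooth u \<and> (\<forall>z. u z \<in> hyperbolic_plane) \<and>
     (\<forall>z. partial None u z =
        eta (\<Sum>l\<in>UNIV. partial (Some l) (\<lambda>y. cross3 (u y) (partial (Some l) u y)) z))"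

end

theory Submission
  imports Defs
begin

text \<open>
  Let \<open>q\<^sub>0 = \<i> D\<^sub>j q\<^sub>j\<close> and put the base point and the frame into one triad \<open>X = (u, e, f)\<close> with
  \<open>f = J e\<close>. In terms of \<open>X\<close> the required equations are the linear system
  \<open>\<partial>\<^sub>\<alpha> X = G\<^sub>\<alpha> X\<close>, where \<open>G\<^sub>\<alpha>\<close> depends only on \<open>q\<^sub>\<alpha>\<close> and \<open>a\<^sub>\<alpha>\<close>:
  \<open>\<partial>\<^sub>\<alpha> u = Re q\<^sub>\<alpha> e + Im q\<^sub>\<alpha> f\<close>, \<open>\<partial>\<^sub>\<alpha> e = Re q\<^sub>\<alpha> u + a\<^sub>\<alpha> f\<close>, \<open>\<partial>\<^sub>\<alpha> f = Im q\<^sub>\<alpha> u - a\<^sub>\<alpha> e\<close>.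
  So \<open>X\<close> is a parallel section of a linear connection on a trivial bundle over space-time, and the
  theorem says that such a section exists and is unique for given initial data.

  The curvature of this connection vanishes exactly when \<open>D\<^sub>\<alpha> q\<^sub>\<beta> = D\<^sub>\<beta> q\<^sub>\<alpha>\<close> and
  \<open>\<partial>\<^sub>\<alpha> a\<^sub>\<beta> - \<partial>\<^sub>\<beta> a\<^sub>\<alpha> = - \<langle>q\<^sub>\<alpha>, \<i> q\<^sub>\<beta>\<rangle>\<close> for all space-time indices (\<open>frame_op_zero_curvature\<close>). The only
  one of these identities that is not assumed is \<open>D\<^sub>t q\<^sub>\<ell> = D\<^sub>\<ell> q\<^sub>0\<close>; it is the evolution equation with
  \<open>D\<^sub>k D\<^sub>\<ell>\<close> commuted to \<open>D\<^sub>\<ell> D\<^sub>k\<close> (\<open>time_compatibility\<close>).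

  A flat connection \<open>\<Gamma>\<close> over a Euclidean space has a parallel section through every initial value
  (\<open>parallel_exists\<close>). It is obtained by Picard iteration of the equation along rays,
  \<open>X z = x\<^sub>0 + \<integral>\<^sub>0\<^sup>1 \<Gamma>(s z) z X(s z) ds\<close>. The limit must solve the equation in all directions and not only
  along rays. For this the derivative of each iterate is computed from the homotopy formula of the
  Poincare lemma (\<open>radial_integral_has_derivative\<close>). By flatness, the defect
  \<open>E\<^sub>n = dX\<^sub>n - \<Gamma> X\<^sub>n\<close> then satisfies a recursion of the same Volterra type as the increments
  \<open>X\<^sub>n\<^sub>+\<^sub>1 - X\<^sub>n\<close>, hence tends to zero locally uniformly (\<open>defect_bound\<close>), and differentiation may be
  exchanged with the limit. Uniqueness is the same factorial estimate (\<open>parallel_zero\<close>).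

  That the parallel triad really is a frame over a map into the hyperbolic plane also follows from
  uniqueness: the dual triad \<open>(\<eta>(f \<times> e), \<eta>(f \<times> u), \<eta>(u \<times> e))\<close> satisfies the same linear system with
  the same initial value (\<open>triad_equations_dual\<close>), so it equals \<open>(u, e, f)\<close>. This contains \<open>f = J e\<close>
  and all orthogonality relations; the remaining normalisation \<open>\<langle>\<eta> u, u\<rangle> = -1\<close> is a constant of the
  system. Finally, the equation \<open>q\<^sub>0 = \<i> D\<^sub>j q\<^sub>j\<close> read in the frame is the Schroedinger map equation
  (\<open>frame_schroedinger\<close>).
\<close>

section \<open>Finite-order differentiability\<close>

abbreviation deriv_along :: "('a::real_normed_vector \<Rightarrow> 'b::real_normed_vector) \<Rightarrow> 'a \<Rightarrow> 'a \<Rightarrow> 'b"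
  where "deriv_along f z v \<equiv> frechet_derivative f (at z) v"

lemma times_differentiable_SucI:
  assumes "\<And>z. (f has_derivative f' z) (at z)" and "\<And>v. times_differentiable n (\<lambda>z. f' z v)"
  shows "times_differentiable (Suc n) f"
  using assms frechet_derivative_at[OF assms(1)] by (auto simp: differentiable_def)

lemma times_differentiable_has_derivative:
  assumes "times_differentiable (Suc n) f"
  shows "(f has_derivative deriv_along f z) (at z)"
  using assms by (simp add: frechet_derivative_works)

lemma times_differentiable_deriv:
  "times_differentiable (Suc n) f \<Longrightarrow> times_differentiable n (\<lambda>z. deriv_along f z v)"
  by simp

lemma C1_has_derivative:
  "times_differentiable 1 f \<Longrightarrow> (f has_derivative deriv_along f z) (at z)"
  unfolding One_nat_def by (rule times_differentiable_has_derivative)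

lemma times_differentiable_continuous:
  assumes "times_differentiable n f" shows "continuous_on S f"
proof (cases n)
  case 0
  with assms show ?thesis by (auto intro: continuous_on_subset)
next
  case (Suc k)
  with assms show ?thesis
    by (metis times_differentiable_has_derivative has_derivative_continuous
        continuous_at_imp_continuous_on)
qed

lemma C1_continuous_deriv:
  "times_differentiable 1 f \<Longrightarrow> continuous_on S (\<lambda>z. deriv_along f z v)"
  unfolding One_nat_def by (rule times_differentiable_continuous[OF times_differentiable_deriv])

lemma times_differentiable_SucD: "times_differentiable (Suc n) f \<Longrightarrow> times_differentiable n f"
proof (induction n arbitrary: f)
  case 0
  then show ?case using times_differentiable_continuous by (metis times_differentiable.simps(1))
qed simp

lemma times_differentiable_const: "times_differentiable n (\<lambda>z. c)"
proof (induction n arbitrary: c)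
  case (Suc n)
  show ?case by (rule times_differentiable_SucI[where f' = "\<lambda>z v. 0"]) (auto intro: Suc)
qed simp

lemma times_differentiable_bounded_linear:
  assumes "bounded_linear h" "times_differentiable n f"
  shows "times_differentiable n (\<lambda>z. h (f z))"
  using assms(2)
proof (induction n arbitrary: f)
  case 0
  then show ?case
    using assms(1) by (simp add: linear_continuous_on bounded_linear.continuous_on)
next
  case (Suc n)
  show ?case
    by (rule times_differentiable_SucI)
      (use bounded_linear.has_derivative[OF assms(1) times_differentiable_has_derivative] Suc
        in auto)
qed

lemma times_differentiable_add:
  assumes "times_differentiable n f" "times_differentiable n g"
  shows "times_differentiable n (\<lambda>z. f z + g z)"
  using assms
proof (induction n arbitrary: f g)
  case 0
  then show ?case by (simp add: continuous_on_add)
next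
  case (Suc n)
  show ?case
    by (rule times_differentiable_SucI,
        rule has_derivative_add[OF times_differentiable_has_derivative[OF Suc.prems(1)]
          times_differentiable_has_derivative[OF Suc.prems(2)]])
      (intro Suc.IH times_differentiable_deriv Suc.prems)
qed

lemma times_differentiable_sum:
  "(\<And>i. i \<in> I \<Longrightarrow> times_differentiable n (f i)) \<Longrightarrow> times_differentiable n (\<lambda>z. \<Sum>i\<in>I. f i z)"
  by (induction I rule: infinite_finite_induct)
    (auto intro: times_differentiable_const times_differentiable_add)

lemma times_differentiable_bilinear:
  assumes "bounded_bilinear prd" "times_differentiable n f" "times_differentiable n g"
  shows "times_differentiable n (\<lambda>z. prd (f z) (g z))"
  using assms(2,3)
proof (induction n arbitrary: f g)
  case 0
  then show ?case by (simp add: bounded_bilinear.continuous_on[OF assms(1)])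
next
  case (Suc n)
  show ?case
    by (rule times_differentiable_SucI,
        rule bounded_bilinear.FDERIV[OF assms(1) times_differentiable_has_derivative[OF Suc.prems(1)]
          times_differentiable_has_derivative[OF Suc.prems(2)]])
      (intro times_differentiable_add Suc.IH times_differentiable_deriv Suc.prems
        times_differentiable_SucD)
qed

lemma times_differentiable_Pair:
  assumes "times_differentiable n f" "times_differentiable n g"
  shows "times_differentiable n (\<lambda>z. (f z, g z))"
proof -
  have "bounded_linear (\<lambda>x. (x, 0))" "bounded_linear (\<lambda>y. (0, y))"
    by (auto intro!: bounded_linear_Pair bounded_linear_ident bounded_linear_zero)
  from times_differentiable_add[OF times_differentiable_bounded_linear[OF this(1) assms(1)]
      times_differentiable_bounded_linear[OF this(2) assms(2)]]
  show ?thesis by simp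
qed

lemma has_derivative_translate:
  assumes "(f has_derivative f') (at (c + z))"
  shows "((\<lambda>y. f (c + y)) has_derivative f') (at z)"
  by (rule has_derivative_compose[where f = "\<lambda>y. c + y", OF _ assms]) (auto intro!: derivative_eq_intros)

lemma times_differentiable_translate:
  "times_differentiable n f \<Longrightarrow> times_differentiable n (\<lambda>z. f (c + z))"
proof (induction n arbitrary: f)
  case 0
  then show ?case by (auto intro!: continuous_on_compose2[of UNIV f] continuous_intros)
next
  case (Suc n)
  show ?case
    by (rule times_differentiable_SucI,
        rule has_derivative_translate[OF times_differentiable_has_derivative[OF Suc.prems]])
      (rule Suc.IH, rule times_differentiable_deriv, rule Suc.prems)
qed

lemma deriv_along_unique: "(f has_derivative f') (at z) \<Longrightarrow> deriv_along f z v = f' v"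
  using frechet_derivative_at by metis

section \<open>Integrating one-forms along rays\<close>

lemma linear_form_expand:
  fixes \<omega> :: "'a::euclidean_space \<Rightarrow> 'b::real_vector"
  assumes "linear \<omega>" shows "\<omega> v = (\<Sum>b\<in>Basis. (v \<bullet> b) *\<^sub>R \<omega> b)"
  by (subst euclidean_representation[of v, symmetric]) (simp only: linear_sum[OF assms] linear_scale[OF assms])

text \<open>Expansion in a basis: it reduces joint continuity in the base point and the argument of a form to
  continuity of its finitely many coefficients.\<close>

lemma linear_form_derivative:
  fixes \<omega> :: "'a::euclidean_space \<Rightarrow> 'a \<Rightarrow> 'b::real_normed_vector"
  assumes lin: "\<And>z. linear (\<omega> z)" and C1: "\<And>v. times_differentiable 1 (\<lambda>z. \<omega> z v)"
  shows "deriv_along (\<lambda>y. \<omega> y v) z w = (\<Sum>b\<in>Basis. (v \<bullet> b) *\<^sub>R deriv_along (\<lambda>y. \<omega> y b) z w)"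
proof (rule deriv_along_unique)
  have "\<omega> z v = (\<Sum>b\<in>Basis. (v \<bullet> b) *\<^sub>R \<omega> z b)" for z
    by (rule linear_form_expand[OF lin])
  moreover have "((\<lambda>z. \<Sum>b\<in>Basis. (v \<bullet> b) *\<^sub>R \<omega> z b) has_derivative
      (\<lambda>w. \<Sum>b\<in>Basis. (v \<bullet> b) *\<^sub>R deriv_along (\<lambda>y. \<omega> y b) z w)) (at z)"
    by (intro has_derivative_sum has_derivative_scaleR_right C1_has_derivative C1)
  ultimately show "((\<lambda>y. \<omega> y v) has_derivative
      (\<lambda>w. \<Sum>b\<in>Basis. (v \<bullet> b) *\<^sub>R deriv_along (\<lambda>y. \<omega> y b) z w)) (at z)"
    by simp
qed

text \<open>The homotopy formula \<open>d K \<omega> = \<omega> - K d\<omega>\<close> of the Poincare lemma, where \<open>K\<close> integrates along the ray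
  from the origin. Differentiation under the integral sign produces
  \<open>\<integral> \<omega>(s z) v + s d\<omega>(s z)(v, z) ds\<close>, and \<open>\<omega>(s z) v + s d\<omega>(s z)(z, v)\<close> is the \<open>s\<close>-derivative of
  \<open>s \<omega>(s z) v\<close>.\<close>

lemma radial_integral_has_derivative:
  fixes \<omega> :: "'a::euclidean_space \<Rightarrow> 'a \<Rightarrow> 'b::banach"
  assumes lin: "\<And>z. linear (\<omega> z)" and C1: "\<And>v. times_differentiable 1 (\<lambda>z. \<omega> z v)"
  defines "d\<omega> \<equiv> \<lambda>z w v. deriv_along (\<lambda>y. \<omega> y v) z w"
  shows "((\<lambda>z. integral {0..1} (\<lambda>s. \<omega> (s *\<^sub>R z) z)) has_derivative
      (\<lambda>v. \<omega> z v + integral {0..1} (\<lambda>s. s *\<^sub>R (d\<omega> (s *\<^sub>R z) v z - d\<omega> (s *\<^sub>R z) z v)))) (at z)"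
proof -
  have td: "((\<lambda>y. \<omega> y v) has_derivative (\<lambda>w. d\<omega> z w v)) (at z)" for z v
    unfolding d\<omega>_def by (rule C1_has_derivative[OF C1])
  have d\<omega>_sum: "d\<omega> z w v = (\<Sum>b\<in>Basis. (v \<bullet> b) *\<^sub>R d\<omega> z w b)" for z w v
    unfolding d\<omega>_def by (rule linear_form_derivative[OF lin C1])
  have d\<omega>_lin: "linear (\<lambda>w. d\<omega> z w v)" for z v
    using td has_derivative_linear by blast
  have \<omega>_cont: "continuous_on S (\<lambda>z. \<omega> z v)" for v S
    by (rule times_differentiable_continuous[OF C1])
  have d\<omega>_cont: "continuous_on S (\<lambda>z. d\<omega> z w v)" for v w S
    unfolding d\<omega>_def by (rule C1_continuous_deriv[OF C1])
  note conts = continuous_on_compose2[OF \<omega>_cont[of UNIV]] continuous_on_compose2[OF d\<omega>_cont[of UNIV]]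
  define F where "F z s v = \<omega> (s *\<^sub>R z) v + s *\<^sub>R d\<omega> (s *\<^sub>R z) v z" for z s v
  have F_deriv: "((\<lambda>z. \<omega> (s *\<^sub>R z) z) has_derivative F z s) (at z)" for z s
  proof -
    have 1: "((\<lambda>z. \<omega> (s *\<^sub>R z) b) has_derivative (\<lambda>v. d\<omega> (s *\<^sub>R z) (s *\<^sub>R v) b)) (at z)" for b
      by (rule has_derivative_compose[where f = "\<lambda>z. s *\<^sub>R z" and g = "\<lambda>y. \<omega> y b", OF _ td])
        (auto intro!: derivative_eq_intros)
    have 2: "((\<lambda>z. \<Sum>b\<in>Basis. (z \<bullet> b) *\<^sub>R \<omega> (s *\<^sub>R z) b) has_derivative
        (\<lambda>v. \<Sum>b\<in>Basis. (z \<bullet> b) *\<^sub>R d\<omega> (s *\<^sub>R z) (s *\<^sub>R v) b + (v \<bullet> b) *\<^sub>R \<omega> (s *\<^sub>R z) b)) (at z)"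
      by (intro has_derivative_sum has_derivative_scaleR 1 has_derivative_inner_left has_derivative_ident)
    have 3: "(\<Sum>b\<in>Basis. (z \<bullet> b) *\<^sub>R d\<omega> (s *\<^sub>R z) (s *\<^sub>R v) b + (v \<bullet> b) *\<^sub>R \<omega> (s *\<^sub>R z) b) = F z s v" for v
      unfolding sum.distrib d\<omega>_sum[symmetric] linear_form_expand[OF lin, symmetric]
      by (simp add: F_def linear_scale[OF d\<omega>_lin])
    show ?thesis
      using 2 unfolding 3 linear_form_expand[OF lin, symmetric] .
  qed
  have F_blin: "bounded_linear (F z s)" for z s
    using F_deriv has_derivative_bounded_linear by blast
  have F_cont: "continuous_on (UNIV \<times> cbox 0 1) (\<lambda>(z, s). Blinfun (F z s))"
    unfolding case_prod_unfold
  proof (rule continuous_on_blinfun_componentwise)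
    fix i :: 'a assume "i \<in> Basis"
    show "continuous_on (UNIV \<times> cbox 0 1) (\<lambda>p. blinfun_apply (Blinfun (F (fst p) (snd p))) i)"
      unfolding bounded_linear_Blinfun_apply[OF F_blin] F_def
      by (subst d\<omega>_sum) (intro continuous_intros conts subset_UNIV)
  qed
  have d1: "((\<lambda>z. integral (cbox 0 1) (\<lambda>s. \<omega> (s *\<^sub>R z) z)) has_derivative
      integral (cbox 0 1) (\<lambda>s. Blinfun (F z s))) (at z within UNIV)"
  proof (rule leibniz_rule[OF _ _ F_cont])
    fix z :: 'a
    show "(\<lambda>s. \<omega> (s *\<^sub>R z) z) integrable_on cbox 0 1"
      by (auto intro!: integrable_continuous_real conts continuous_intros)
  qed (auto simp: bounded_linear_Blinfun_apply[OF F_blin] intro: F_deriv has_derivative_at_withinI)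
  have int: "continuous_on {0..1} f \<Longrightarrow> f integrable_on {0..1}" for f :: "real \<Rightarrow> 'b"
    by (rule integrable_continuous_real)
  have F_int: "blinfun_apply (integral (cbox 0 1) (\<lambda>s. Blinfun (F z s))) v =
      \<omega> z v + integral {0..1} (\<lambda>s. s *\<^sub>R (d\<omega> (s *\<^sub>R z) v z - d\<omega> (s *\<^sub>R z) z v))" for v
  proof -
    have "continuous_on (cbox 0 1) (\<lambda>s. (\<lambda>(z, s). Blinfun (F z s)) (z, s))"
      by (rule continuous_on_compose2[OF F_cont]) (auto intro!: continuous_intros)
    then have "continuous_on (cbox 0 1) (\<lambda>s. Blinfun (F z s))"
      by (simp only: prod.case)
    then have 1: "blinfun_apply (integral (cbox 0 1) (\<lambda>s. Blinfun (F z s))) v =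
        integral {0..1} (\<lambda>s. F z s v)"
      unfolding cbox_interval[symmetric]
      by (subst blinfun_apply_integral[OF integrable_continuous])
        (simp_all only: bounded_linear_Blinfun_apply[OF F_blin])
    have "((\<lambda>s. s *\<^sub>R \<omega> (s *\<^sub>R z) v) has_vector_derivative
        (\<omega> (s *\<^sub>R z) v + s *\<^sub>R d\<omega> (s *\<^sub>R z) z v)) (at s within {0..1})" for s
    proof -
      have "((\<lambda>s. \<omega> (s *\<^sub>R z) v) has_derivative (\<lambda>h. d\<omega> (s *\<^sub>R z) (h *\<^sub>R z) v)) (at s within {0..1})"
        by (rule has_derivative_compose[where f = "\<lambda>s. s *\<^sub>R z" and g = "\<lambda>y. \<omega> y v", OF _ td])
          (auto intro!: derivative_eq_intros)
      then show ?thesis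
        unfolding has_vector_derivative_def
        by (auto intro!: derivative_eq_intros simp: linear_scale[OF d\<omega>_lin] algebra_simps)
    qed
    from fundamental_theorem_of_calculus[OF _ this]
    have 2: "((\<lambda>s. \<omega> (s *\<^sub>R z) v + s *\<^sub>R d\<omega> (s *\<^sub>R z) z v) has_integral \<omega> z v) {0..1}"
      by simp
    have "((\<lambda>s. s *\<^sub>R (d\<omega> (s *\<^sub>R z) v z - d\<omega> (s *\<^sub>R z) z v)) has_integral
        integral {0..1} (\<lambda>s. s *\<^sub>R (d\<omega> (s *\<^sub>R z) v z - d\<omega> (s *\<^sub>R z) z v))) {0..1}"
      by (intro integrable_integral int continuous_intros conts subset_UNIV)
    from integral_unique[OF has_integral_add[OF 2 this]] 1 show ?thesis
      by (simp add: F_def algebra_simps)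
  qed
  show ?thesis
    using d1 unfolding F_int[abs_def] by simp
qed

lemma times_differentiable_radial_integral:
  fixes \<omega> :: "'a::euclidean_space \<Rightarrow> 'a \<Rightarrow> 'b::banach"
  assumes lin: "\<And>z. linear (\<omega> z)" and C1: "\<And>v. times_differentiable 1 (\<lambda>z. \<omega> z v)"
  shows "times_differentiable 1 (\<lambda>z. integral {0..1} (\<lambda>s. \<omega> (s *\<^sub>R z) z))"
  unfolding One_nat_def
proof (rule times_differentiable_SucI[OF radial_integral_has_derivative[OF lin C1]])
  fix v
  define d\<omega> where "d\<omega> z w v = deriv_along (\<lambda>y. \<omega> y v) z w" for z w v
  have \<omega>_cont: "continuous_on S (\<lambda>z. \<omega> z v)" for v S
    by (rule times_differentiable_continuous[OF C1])
  have d\<omega>_cont: "continuous_on S (\<lambda>z. d\<omega> z w v)" for v w S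
    unfolding d\<omega>_def by (rule C1_continuous_deriv[OF C1])
  note conts = continuous_on_compose2[OF \<omega>_cont[of UNIV]] continuous_on_compose2[OF d\<omega>_cont[of UNIV]]
  have 1: "d\<omega> y v z = (\<Sum>b\<in>Basis. (z \<bullet> b) *\<^sub>R d\<omega> y v b)" for y z
    unfolding d\<omega>_def by (rule linear_form_derivative[OF lin C1])
  have "linear (\<lambda>w. d\<omega> y w v)" for y
    unfolding d\<omega>_def by (rule has_derivative_linear[OF C1_has_derivative[OF C1]])
  then have 2: "d\<omega> y z v = (\<Sum>b\<in>Basis. (z \<bullet> b) *\<^sub>R d\<omega> y b v)" for y z
    by (rule linear_form_expand)
  have "continuous_on UNIV (\<lambda>z. integral (cbox 0 1) (\<lambda>s. s *\<^sub>R (d\<omega> (s *\<^sub>R z) v z - d\<omega> (s *\<^sub>R z) z v)))"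
    by (rule integral_continuous_on_param, unfold case_prod_unfold, subst 1, subst 2)
      (intro continuous_intros conts subset_UNIV)
  then show "times_differentiable 0 (\<lambda>z. \<omega> z v + integral {0..1} (\<lambda>s. s *\<^sub>R
      (deriv_along (\<lambda>y. \<omega> y z) (s *\<^sub>R z) v - deriv_along (\<lambda>y. \<omega> y v) (s *\<^sub>R z) z)))"
    by (simp add: d\<omega>_def \<omega>_cont continuous_on_add)
qed

text \<open>Radial integration of the exact form \<open>df\<close> returns \<open>f\<close> up to a constant, so the correction term in
  the homotopy formula, which is the radial average of the antisymmetric part of the second
  derivative, vanishes on every ray. Shrinking the ray to its origin leaves the symmetry of the
  second derivative there.\<close>

lemma symmetric_second_derivative:
  fixes f :: "'a::euclidean_space \<Rightarrow> 'b::banach"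
  assumes f: "times_differentiable 2 f"
  shows "deriv_along (\<lambda>y. deriv_along f y v) z w = deriv_along (\<lambda>y. deriv_along f y w) z v"
proof -
  define g where "g y = f (z + y)" for y
  have g: "times_differentiable 2 g"
    unfolding g_def by (rule times_differentiable_translate[OF f])
  then have g': "(g has_derivative deriv_along g y) (at y)" for y
    by (metis times_differentiable_has_derivative Suc_1)
  have lin: "linear (deriv_along g y)" for y
    using g' has_derivative_linear by blast
  have C1: "times_differentiable 1 (\<lambda>y. deriv_along g y v)" for v
    using g times_differentiable_deriv by (metis Suc_1 One_nat_def)
  define H where "H y w v = deriv_along (\<lambda>y. deriv_along g y v) y w" for y w v
  have H_lin1: "linear (\<lambda>w. H y w v)" for y v
    unfolding H_def by (rule has_derivative_linear[OF C1_has_derivative[OF C1]])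
  have H_sum: "H y w v = (\<Sum>b\<in>Basis. (v \<bullet> b) *\<^sub>R H y w b)" for y w v
    unfolding H_def by (rule linear_form_derivative[OF lin C1])
  have H_scale2: "H y w (c *\<^sub>R v) = c *\<^sub>R H y w v" for y w v c
    by (subst (1 2) H_sum) (simp add: scaleR_sum_right)
  have H_cont: "continuous_on S (\<lambda>z. H z w v)" for v w S
    unfolding H_def by (rule C1_continuous_deriv[OF C1])
  have "((\<lambda>s. deriv_along g (s *\<^sub>R y) y) has_integral g (1 *\<^sub>R y) - g (0 *\<^sub>R y)) {0..1}" for y
  proof (rule fundamental_theorem_of_calculus)
    fix s :: real
    have "((\<lambda>s. g (s *\<^sub>R y)) has_derivative (\<lambda>h. deriv_along g (s *\<^sub>R y) (h *\<^sub>R y))) (at s within {0..1})"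
      by (rule has_derivative_compose[where f = "\<lambda>s. s *\<^sub>R y" and g = g, OF _ g'])
        (auto intro!: derivative_eq_intros)
    then show "((\<lambda>s. g (s *\<^sub>R y)) has_vector_derivative deriv_along g (s *\<^sub>R y) y) (at s within {0..1})"
      by (simp add: has_vector_derivative_def linear_scale[OF lin])
  qed simp
  then have "integral {0..1} (\<lambda>s. deriv_along g (s *\<^sub>R y) y) = g y - g 0" for y
    by (auto intro: integral_unique)
  then have "(g has_derivative
      (\<lambda>v. deriv_along g y v + integral {0..1} (\<lambda>s. s *\<^sub>R (H (s *\<^sub>R y) v y - H (s *\<^sub>R y) y v)))) (at y)" for y
    using has_derivative_add[OF radial_integral_has_derivative[OF lin C1] has_derivative_const[of "g 0"], of y]
    unfolding H_def by simp
  note K = deriv_along_unique[OF this]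
  have zero: "integral {0..1} (\<lambda>s. s *\<^sub>R (H (s *\<^sub>R y) v y - H (s *\<^sub>R y) y v)) = 0" for y v
    using K[of y v] by simp
  \<comment> \<open>along the ray through \<open>r w\<close> the vanishing average is \<open>r\<close> times \<open>\<Phi> r\<close>; the value of interest is \<open>\<Phi> 0\<close>\<close>
  define \<Phi> where "\<Phi> r = integral (cbox 0 1) (\<lambda>s. s *\<^sub>R (H (s *\<^sub>R r *\<^sub>R w) v w - H (s *\<^sub>R r *\<^sub>R w) w v))" for r :: real
  have "\<Phi> r = 0" if "r \<noteq> 0" for r
  proof -
    have "s *\<^sub>R (H (s *\<^sub>R r *\<^sub>R w) v (r *\<^sub>R w) - H (s *\<^sub>R r *\<^sub>R w) (r *\<^sub>R w) v) =
        r *\<^sub>R (s *\<^sub>R (H (s *\<^sub>R r *\<^sub>R w) v w - H (s *\<^sub>R r *\<^sub>R w) w v))" for s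
      unfolding H_scale2 linear_scale[OF H_lin1] by (simp add: scaleR_diff_right mult.commute)
    note eq = this
    have "r *\<^sub>R \<Phi> r = 0"
      using zero[of "r *\<^sub>R w" v] unfolding eq \<Phi>_def cbox_interval integral_cmul .
    with that show ?thesis by simp
  qed
  moreover have "continuous_on UNIV \<Phi>"
    unfolding \<Phi>_def
    by (rule integral_continuous_on_param, unfold case_prod_unfold)
      (intro continuous_intros continuous_on_compose2[OF H_cont[of UNIV]] subset_UNIV)
  then have "(\<Phi> \<longlongrightarrow> \<Phi> 0) (at 0)"
    by (simp add: continuous_on_def)
  moreover have "(\<Phi> \<longlongrightarrow> 0) (at 0)"
    using \<open>\<And>r. r \<noteq> 0 \<Longrightarrow> \<Phi> r = 0\<close> by (intro tendsto_eventually) (auto simp: eventually_at intro: exI[of _ 1])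
  ultimately have "\<Phi> 0 = 0"
    using LIM_unique by blast
  moreover have "\<Phi> 0 = (1/2) *\<^sub>R (H 0 v w - H 0 w v)"
  proof -
    have "((\<lambda>s. s *\<^sub>R (H 0 v w - H 0 w v)) has_integral (1/2) *\<^sub>R (H 0 v w - H 0 w v)) {0..1::real}"
      using has_integral_scaleR_left[OF ident_has_integral[of 0 1]] by simp
    then show ?thesis unfolding \<Phi>_def by (auto intro: integral_unique)
  qed
  ultimately have eq: "H 0 v w = H 0 w v" by simp
  have f2: "times_differentiable (Suc 1) f"
    using f by (simp only: Suc_1)
  have "deriv_along g y u = deriv_along f (z + y) u" for y u
    unfolding g_def
    by (rule deriv_along_unique has_derivative_translate times_differentiable_has_derivative[OF f2])+
  then have "H 0 w v = deriv_along (\<lambda>y. deriv_along f (z + y) v) 0 w" for w v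
    unfolding H_def by simp
  also have "deriv_along (\<lambda>y. deriv_along f (z + y) v) 0 w = deriv_along (\<lambda>y. deriv_along f y v) z w" for w v
  proof (rule deriv_along_unique, rule has_derivative_translate)
    show "((\<lambda>y. deriv_along f y v) has_derivative deriv_along (\<lambda>y. deriv_along f y v) z) (at (z + 0))"
      using C1_has_derivative[OF times_differentiable_deriv[OF f2]] by simp
  qed
  finally show ?thesis using eq by simp
qed

section \<open>Linear connections\<close>

lemma has_integral_power_unit: "((\<lambda>s. s ^ n) has_integral 1 / (real n + 1)) {0..1::real}"
proof -
  have "((\<lambda>s. s ^ Suc n / (real n + 1)) has_vector_derivative s ^ n) (at s within {0..1})" for s :: real
    unfolding has_real_derivative_iff_has_vector_derivative[symmetric]
    by (auto intro!: derivative_eq_intros simp: divide_simps simp del: power_Suc)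
  from fundamental_theorem_of_calculus[OF _ this] show ?thesis by simp
qed

text \<open>The source of all factorials below: a bound of order \<open>s\<^sup>n\<close> along a ray gains a factor
  \<open>1 / (n + 1)\<close> under radial integration.\<close>

lemma norm_integral_le_power:
  fixes f :: "real \<Rightarrow> 'b::banach"
  assumes "continuous_on {0..1} f" "\<And>s. s \<in> {0..1} \<Longrightarrow> norm (f s) \<le> B * s ^ n"
  shows "norm (integral {0..1} f) \<le> B / (real n + 1)"
proof -
  have *: "((\<lambda>s. B * s ^ n) has_integral B * (1 / (real n + 1))) {0..1}"
    by (rule has_integral_mult_right[OF has_integral_power_unit])
  then have "norm (integral {0..1} f) \<le> integral {0..1} (\<lambda>s. B * s ^ n)"
    by (intro integral_norm_bound_integral assms integrable_continuous_real)
      (auto intro!: continuous_intros)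
  also have "\<dots> = B / (real n + 1)"
    using integral_unique[OF *] by simp
  finally show ?thesis .
qed

text \<open>The connection form of the trivial bundle with fibre \<^typ>\<open>'b\<close>: \<open>\<Gamma> z v\<close> is the infinitesimal transport
  at \<open>z\<close> in the direction \<open>v\<close>. It is a family of operators that is linear in \<open>v\<close> (instead of
  a nested operator type), so that regularity is stated for one direction at a time.\<close>

locale linear_connection =
  fixes \<Gamma> :: "'a::euclidean_space \<Rightarrow> 'a \<Rightarrow> 'b::banach \<Rightarrow>\<^sub>L 'b"
  assumes lin: "\<And>z. linear (\<Gamma> z)"
    and C1: "\<And>v. times_differentiable 1 (\<lambda>z. \<Gamma> z v)"
begin

definition parallel :: "('a \<Rightarrow> 'b) \<Rightarrow> bool" where
  "parallel X \<longleftrightarrow> (\<forall>z. (X has_derivative (\<lambda>v. \<Gamma> z v (X z))) (at z))"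

lemma locally_bounded:
  obtains c where "c > 0" "\<And>z v. norm z \<le> R \<Longrightarrow> norm (\<Gamma> z v) \<le> c * norm v"
proof -
  have "continuous_on (cball 0 R) (\<lambda>z. \<Sum>b\<in>Basis. norm (\<Gamma> z b))"
    by (intro continuous_intros times_differentiable_continuous[OF C1])
  then have "bounded ((\<lambda>z. \<Sum>b\<in>Basis. norm (\<Gamma> z b)) ` cball 0 R)"
    by (intro compact_imp_bounded compact_continuous_image) auto
  then obtain c where c: "c > 0" "\<And>z. norm z \<le> R \<Longrightarrow> norm (\<Sum>b\<in>Basis. norm (\<Gamma> z b)) \<le> c"
    unfolding bounded_pos by (auto simp: mem_cball)
  have "norm (\<Gamma> z v) \<le> c * norm v" if "norm z \<le> R" for z v
  proof -
    have "norm (\<Gamma> z v) \<le> (\<Sum>b\<in>Basis. \<bar>v \<bullet> b\<bar> * norm (\<Gamma> z b))"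
      by (subst linear_form_expand[OF lin]) (rule order_trans[OF norm_sum], simp)
    also have "\<dots> \<le> (\<Sum>b\<in>Basis. norm v * norm (\<Gamma> z b))"
      by (intro sum_mono mult_right_mono Basis_le_norm) auto
    also have "\<dots> = norm v * (\<Sum>b\<in>Basis. norm (\<Gamma> z b))"
      by (simp add: sum_distrib_left)
    also have "\<dots> \<le> norm v * c"
      using c(2)[OF that] by (intro mult_left_mono) auto
    finally show ?thesis by (simp add: mult.commute)
  qed
  with c(1) show thesis by (rule that)
qed

lemma form_linear: "linear (\<lambda>v. \<Gamma> z v x)"
  by (rule linearI) (simp_all add: linear_add[OF lin] linear_scale[OF lin] blinfun.bilinear_simps)

lemma form_C1: "times_differentiable 1 X \<Longrightarrow> times_differentiable 1 (\<lambda>z. \<Gamma> z v (X z))"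
  by (rule times_differentiable_bilinear[OF bounded_bilinear_blinfun_apply C1])

lemma form_continuous: "continuous_on S X \<Longrightarrow> continuous_on S (\<lambda>z. \<Gamma> z v (X z))"
  by (intro blinfun.continuous_on times_differentiable_continuous[OF C1])

lemma form_deriv:
  assumes "times_differentiable 1 X"
  shows "deriv_along (\<lambda>y. \<Gamma> y v (X y)) z w =
    \<Gamma> z v (deriv_along X z w) + blinfun_apply (deriv_along (\<lambda>y. \<Gamma> y v) z w) (X z)"
  by (rule deriv_along_unique, rule bounded_bilinear.FDERIV[OF bounded_bilinear_blinfun_apply])
    (rule C1_has_derivative[OF C1] C1_has_derivative[OF assms])+

primrec picard :: "'b \<Rightarrow> nat \<Rightarrow> 'a \<Rightarrow> 'b" where
  "picard x0 0 z = x0"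
| "picard x0 (Suc n) z = x0 + integral {0..1} (\<lambda>s. \<Gamma> (s *\<^sub>R z) z (picard x0 n (s *\<^sub>R z)))"

lemma picard_0_fun: "picard x0 0 = (\<lambda>z. x0)"
  and picard_Suc_fun: "picard x0 (Suc n) =
    (\<lambda>z. x0 + integral {0..1} (\<lambda>s. \<Gamma> (s *\<^sub>R z) z (picard x0 n (s *\<^sub>R z))))"
  by auto

lemma picard_C1: "times_differentiable 1 (picard x0 n)"
proof (induction n)
  case 0
  then show ?case using times_differentiable_const[of 1 x0] by (simp only: picard_0_fun)
next
  case (Suc n)
  have "times_differentiable 1 (\<lambda>z. x0 + integral {0..1} (\<lambda>s. \<Gamma> (s *\<^sub>R z) z (picard x0 n (s *\<^sub>R z))))"
    by (intro times_differentiable_add times_differentiable_const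
        times_differentiable_radial_integral[where \<omega> = "\<lambda>y v. \<Gamma> y v (picard x0 n y)"]
        form_linear form_C1 Suc)
  then show ?case by (simp only: picard_Suc_fun)
qed

lemma radial_continuous:
  assumes "continuous_on UNIV X"
  shows "continuous_on S (\<lambda>s. \<Gamma> (s *\<^sub>R z) v (X (s *\<^sub>R z)))"
  by (rule continuous_on_compose2[OF form_continuous[OF assms]]) (auto intro!: continuous_intros)

lemma picard_increment:
  assumes "c > 0" and c: "\<And>z v. norm z \<le> R \<Longrightarrow> norm (\<Gamma> z v) \<le> c * norm v"
    and "norm z \<le> R"
  shows "norm (picard x0 (Suc n) z - picard x0 n z) \<le> norm x0 * (c * norm z) ^ Suc n / fact (Suc n)"
  using assms(3)
proof (induction n arbitrary: z)
  case 0
  have "norm (integral {0..1} (\<lambda>s. \<Gamma> (s *\<^sub>R z) z x0)) \<le> (norm x0 * (c * norm z)) / (real 0 + 1)"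
  proof (rule norm_integral_le_power)
    show "continuous_on {0..1} (\<lambda>s. \<Gamma> (s *\<^sub>R z) z x0)"
      by (rule radial_continuous) simp
    fix s :: real assume s: "s \<in> {0..1}"
    have "norm (\<Gamma> (s *\<^sub>R z) z x0) \<le> norm (\<Gamma> (s *\<^sub>R z) z) * norm x0" by (rule norm_blinfun)
    also have "\<dots> \<le> c * norm z * norm x0"
      using s 0 by (intro mult_right_mono c) (auto intro: order_trans[OF mult_left_le_one_le])
    finally show "norm (\<Gamma> (s *\<^sub>R z) z x0) \<le> norm x0 * (c * norm z) * s ^ 0" by (simp add: mult_ac)
  qed
  then show ?case by simp
next
  case (Suc n)
  let ?D = "\<lambda>y. picard x0 (Suc n) y - picard x0 n y"
  have cont: "continuous_on S (\<lambda>s. \<Gamma> (s *\<^sub>R z) z (picard x0 k (s *\<^sub>R z)))" for S k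
    by (rule radial_continuous[OF times_differentiable_continuous[OF picard_C1]])
  have "picard x0 (Suc (Suc n)) z - picard x0 (Suc n) z =
      integral {0..1} (\<lambda>s. \<Gamma> (s *\<^sub>R z) z (picard x0 (Suc n) (s *\<^sub>R z)) - \<Gamma> (s *\<^sub>R z) z (picard x0 n (s *\<^sub>R z)))"
    by (subst integral_diff) (auto intro!: integrable_continuous_real cont simp del: picard.simps(2) simp: picard.simps(2)[of x0 _ z])
  also have "\<dots> = integral {0..1} (\<lambda>s. \<Gamma> (s *\<^sub>R z) z (?D (s *\<^sub>R z)))"
    by (simp add: blinfun.diff_right del: picard.simps)
  finally have eq: "picard x0 (Suc (Suc n)) z - picard x0 (Suc n) z = \<dots>" .
  let ?B = "norm x0 * (c * norm z) ^ Suc (Suc n) / fact (Suc n)"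
  have "norm (integral {0..1} (\<lambda>s. \<Gamma> (s *\<^sub>R z) z (?D (s *\<^sub>R z)))) \<le> ?B / (real (Suc n) + 1)"
  proof (rule norm_integral_le_power)
    show "continuous_on {0..1} (\<lambda>s. \<Gamma> (s *\<^sub>R z) z (?D (s *\<^sub>R z)))"
      by (rule radial_continuous) (intro continuous_intros times_differentiable_continuous[OF picard_C1])
    fix s :: real assume s: "s \<in> {0..1}"
    with Suc.prems have sz: "norm (s *\<^sub>R z) \<le> R" by (auto intro: order_trans[OF mult_left_le_one_le])
    have "norm (\<Gamma> (s *\<^sub>R z) z (?D (s *\<^sub>R z))) \<le> norm (\<Gamma> (s *\<^sub>R z) z) * norm (?D (s *\<^sub>R z))"
      by (rule norm_blinfun)
    also have "\<dots> \<le> (c * norm z) * (norm x0 * (c * norm (s *\<^sub>R z)) ^ Suc n / fact (Suc n))"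
      using \<open>c > 0\<close> by (intro mult_mono c sz Suc.IH) auto
    also have "\<dots> = ?B * s ^ Suc n"
      using s by (simp add: power_mult_distrib mult_ac)
    finally show "norm (\<Gamma> (s *\<^sub>R z) z (?D (s *\<^sub>R z))) \<le> ?B * s ^ Suc n" .
  qed
  also have "\<dots> = norm x0 * (c * norm z) ^ Suc (Suc n) / fact (Suc (Suc n))"
    by (simp add: field_simps)
  finally show ?case unfolding eq .
qed

lemma parallel_has_derivative: "parallel X \<Longrightarrow> (X has_derivative (\<lambda>v. \<Gamma> z v (X z))) (at z)"
  by (simp add: parallel_def)

lemma parallel_continuous: "parallel X \<Longrightarrow> continuous_on S X"
  by (meson parallel_has_derivative has_derivative_continuous continuous_at_imp_continuous_on)

lemma parallel_diff:
  assumes "parallel X" "parallel Y" shows "parallel (\<lambda>z. X z - Y z)"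
  using assms unfolding parallel_def by (auto simp: blinfun.diff_right intro!: has_derivative_diff)

lemma parallel_radial_integral:
  assumes "parallel X"
  shows "X z = X 0 + integral {0..1} (\<lambda>s. \<Gamma> (s *\<^sub>R z) z (X (s *\<^sub>R z)))"
proof -
  have "((\<lambda>s. X (s *\<^sub>R z)) has_vector_derivative \<Gamma> (s *\<^sub>R z) z (X (s *\<^sub>R z))) (at s within {0..1})" for s
  proof -
    have "((\<lambda>s. X (s *\<^sub>R z)) has_derivative (\<lambda>h. \<Gamma> (s *\<^sub>R z) (h *\<^sub>R z) (X (s *\<^sub>R z)))) (at s within {0..1})"
      by (rule has_derivative_compose[where f = "\<lambda>s. s *\<^sub>R z" and g = X, OF _ parallel_has_derivative[OF assms]])
        (auto intro!: derivative_eq_intros)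
    then show ?thesis
      by (simp add: has_vector_derivative_def linear_scale[OF lin] blinfun.scaleR_left)
  qed
  from fundamental_theorem_of_calculus[OF _ this] show ?thesis
    by (simp add: integral_unique)
qed

text \<open>Starting from any bound on the ball through \<open>z\<close>, the radial integral equation improves it in each
  step to \<open>M (c |z|)\<^sup>n / n!\<close>, which tends to zero.\<close>

lemma parallel_zero:
  assumes X: "parallel X" and "X 0 = 0"
  shows "X z = 0"
proof -
  define R where "R = norm z"
  obtain c where "c > 0" and c: "\<And>z v. norm z \<le> R \<Longrightarrow> norm (\<Gamma> z v) \<le> c * norm v"
    by (rule locally_bounded[of R], rule that)
  have "bounded (X ` cball 0 R)"
    by (intro compact_imp_bounded compact_continuous_image parallel_continuous X) auto
  then obtain M where "\<forall>y\<in>cball 0 R. norm (X y) \<le> M"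
    unfolding bounded_iff by auto
  then have M: "norm (X y) \<le> M" if "norm y \<le> R" for y
    using that by simp
  have bound: "norm (X y) \<le> M * (c * norm y) ^ n / fact n" if "norm y \<le> R" for y n
    using that
  proof (induction n arbitrary: y)
    case 0
    then show ?case using M by simp
  next
    case (Suc n)
    let ?B = "M * (c * norm y) ^ Suc n / fact n"
    have "norm (integral {0..1} (\<lambda>s. \<Gamma> (s *\<^sub>R y) y (X (s *\<^sub>R y)))) \<le> ?B / (real n + 1)"
    proof (rule norm_integral_le_power)
      show "continuous_on {0..1} (\<lambda>s. \<Gamma> (s *\<^sub>R y) y (X (s *\<^sub>R y)))"
        by (rule radial_continuous[OF parallel_continuous[OF X]])
      fix s :: real assume s: "s \<in> {0..1}"
      with Suc.prems have sy: "norm (s *\<^sub>R y) \<le> R" by (auto intro: order_trans[OF mult_left_le_one_le])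
      have "norm (\<Gamma> (s *\<^sub>R y) y (X (s *\<^sub>R y))) \<le> (c * norm y) * (M * (c * norm (s *\<^sub>R y)) ^ n / fact n)"
        using \<open>c > 0\<close> by (intro order_trans[OF norm_blinfun] mult_mono c sy Suc.IH) auto
      also have "\<dots> = ?B * s ^ n"
        using s by (simp add: power_mult_distrib mult_ac)
      finally show "norm (\<Gamma> (s *\<^sub>R y) y (X (s *\<^sub>R y))) \<le> ?B * s ^ n" .
    qed
    also have "?B / (real n + 1) = M * (c * norm y) ^ Suc n / fact (Suc n)"
      by (simp add: field_simps)
    finally show ?case
      using parallel_radial_integral[OF X, of y] \<open>X 0 = 0\<close> by simp
  qed
  have "(\<lambda>n. M * ((c * norm z) ^ n / fact n)) \<longlonglongrightarrow> M * 0"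
    using summable_LIMSEQ_zero[OF summable_exp[of "c * norm z"]]
    by (intro tendsto_mult_left) (simp add: divide_inverse mult.commute)
  then have "norm (X z) \<le> M * 0"
    by (rule LIMSEQ_le_const) (use bound[of z] in \<open>auto simp: R_def\<close>)
  then show ?thesis by simp
qed

lemma parallel_unique:
  assumes "parallel X" "parallel Y" "X 0 = Y 0"
  shows "X z = Y z"
  using parallel_zero[OF parallel_diff[OF assms(1,2)], of z] assms(3) by simp

text \<open>Bootstrapping: the derivative of \<open>X\<close> is the product \<open>\<Gamma> X\<close>, so it has as many derivatives as \<open>X\<close> itself.\<close>

lemma parallel_smooth:
  assumes X: "parallel X" and \<Gamma>: "\<And>v. smooth (\<lambda>z. \<Gamma> z v)"
  shows "smooth X"
  unfolding smooth_def
proof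
  fix n show "times_differentiable n X"
  proof (induction n)
    case 0
    then show ?case by (simp add: parallel_continuous[OF X])
  next
    case (Suc n)
    show ?case
      by (rule times_differentiable_SucI[OF parallel_has_derivative[OF X]])
        (rule times_differentiable_bilinear[OF bounded_bilinear_blinfun_apply _ Suc],
          use \<Gamma> in \<open>simp add: smooth_def\<close>)
  qed
qed

end

section \<open>Parallel sections of flat connections\<close>

text \<open>Flatness is the equality of the two iterated derivatives that a parallel section would have:
  differentiating \<open>\<Gamma> z v (X z)\<close> in the direction \<open>w\<close> gives the left-hand side with \<open>x = X z\<close>.\<close>

locale flat_connection = linear_connection +
  assumes flat: "\<And>z v w x. blinfun_apply (deriv_along (\<lambda>y. \<Gamma> y v) z w) x + \<Gamma> z v (\<Gamma> z w x) =
      blinfun_apply (deriv_along (\<lambda>y. \<Gamma> y w) z v) x + \<Gamma> z w (\<Gamma> z v x)"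
begin

definition defect :: "'b \<Rightarrow> nat \<Rightarrow> 'a \<Rightarrow> 'a \<Rightarrow> 'b" where
  "defect x0 n z v = deriv_along (picard x0 n) z v - \<Gamma> z v (picard x0 n z)"

lemma defect_continuous: "continuous_on S (\<lambda>z. defect x0 n z v)"
  unfolding defect_def
  by (intro continuous_intros C1_continuous_deriv[OF picard_C1] form_continuous
      times_differentiable_continuous[OF picard_C1])

text \<open>The form \<open>\<Gamma> X\<^sub>n\<close> would be closed if \<open>X\<^sub>n\<close> were parallel; by flatness its exterior derivative is linear in
  the defect. The homotopy formula then expresses the new defect by the old one and the increment.\<close>

lemma defect_Suc:
  "defect x0 (Suc n) z v = \<Gamma> z v (picard x0 n z - picard x0 (Suc n) z) +
    integral {0..1} (\<lambda>s. s *\<^sub>R (\<Gamma> (s *\<^sub>R z) z (defect x0 n (s *\<^sub>R z) v) - \<Gamma> (s *\<^sub>R z) v (defect x0 n (s *\<^sub>R z) z)))"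
proof -
  let ?X = "picard x0 n"
  \<comment> \<open>by flatness, the derivative of \<open>\<Gamma>\<close> is absorbed into the defects\<close>
  have curl: "deriv_along (\<lambda>y. \<Gamma> y z (?X y)) y v - deriv_along (\<lambda>y. \<Gamma> y v (?X y)) y z =
      \<Gamma> y z (defect x0 n y v) - \<Gamma> y v (defect x0 n y z)" for y
    using flat[of z y v "?X y"]
    unfolding form_deriv[OF picard_C1] defect_def by (simp add: blinfun.diff_right algebra_simps)
  have "deriv_along (picard x0 (Suc n)) z v = \<Gamma> z v (?X z) +
    integral {0..1} (\<lambda>s. s *\<^sub>R (\<Gamma> (s *\<^sub>R z) z (defect x0 n (s *\<^sub>R z) v) - \<Gamma> (s *\<^sub>R z) v (defect x0 n (s *\<^sub>R z) z)))"
    unfolding curl[symmetric]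
  proof (rule deriv_along_unique)
    show "(picard x0 (Suc n) has_derivative (\<lambda>v. \<Gamma> z v (?X z) + integral {0..1} (\<lambda>s. s *\<^sub>R
        (deriv_along (\<lambda>y. \<Gamma> y z (?X y)) (s *\<^sub>R z) v - deriv_along (\<lambda>y. \<Gamma> y v (?X y)) (s *\<^sub>R z) z)))) (at z)"
      using has_derivative_add[OF has_derivative_const radial_integral_has_derivative[where \<omega> = "\<lambda>y v. \<Gamma> y v (?X y)",
            OF form_linear form_C1[OF picard_C1]], of x0 z]
      unfolding picard_Suc_fun by simp
  qed
  then show ?thesis
    by (simp add: defect_def[of x0 "Suc n"] blinfun.diff_right del: picard.simps)
qed

text \<open>The wedge product of \<open>\<Gamma>\<close> with the defect consists of two terms, each at most \<open>c |z|\<close> times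
  the previous bound. The constant \<open>4\<close>, instead of the \<open>2\<close> that these two terms require, makes
  them only half of the claim; the increment term takes the other half.\<close>

lemma defect_bound:
  assumes "c > 0" and c: "\<And>z v. norm z \<le> R \<Longrightarrow> norm (\<Gamma> z v) \<le> c * norm v"
    and "norm z \<le> R"
  shows "norm (defect x0 n z v) \<le> c * norm x0 * (4 * c * norm z) ^ n / fact n * norm v"
  using assms(3)
proof (induction n arbitrary: z v)
  case 0
  have "deriv_along (picard x0 0) z v = 0"
    by (rule deriv_along_unique) (simp add: picard_0_fun)
  then have "norm (defect x0 0 z v) \<le> norm (\<Gamma> z v) * norm x0"
    by (simp add: defect_def norm_blinfun)
  also have "\<dots> \<le> c * norm v * norm x0"
    by (intro mult_right_mono c 0) auto
  finally show ?case by (simp add: mult_ac)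
next
  case (Suc n)
  let ?C = "c * norm x0 * (4 * c * norm z) ^ Suc n / fact (Suc n) * norm v"
  have "norm (\<Gamma> z v (picard x0 n z - picard x0 (Suc n) z)) \<le>
      norm (\<Gamma> z v) * norm (picard x0 n z - picard x0 (Suc n) z)"
    by (rule norm_blinfun)
  also have "\<dots> \<le> (c * norm v) * (norm x0 * (c * norm z) ^ Suc n / fact (Suc n))"
    using \<open>c > 0\<close> Suc.prems picard_increment[OF assms(1,2) Suc.prems, of x0 n]
    by (intro mult_mono c) (auto simp del: picard.simps simp: norm_minus_commute)
  also have "\<dots> = ?C / 4 ^ Suc n"
    by (simp add: power_mult_distrib mult_ac)
  also have "\<dots> \<le> ?C / 2"
    using \<open>c > 0\<close> self_le_power[of "4::real" "Suc n"]
    by (intro divide_left_mono) (auto simp del: fact_Suc power_Suc)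
  finally have 1: "norm (\<Gamma> z v (picard x0 n z - picard x0 (Suc n) z)) \<le> ?C / 2" .
  let ?g = "\<lambda>s. s *\<^sub>R (\<Gamma> (s *\<^sub>R z) z (defect x0 n (s *\<^sub>R z) v) - \<Gamma> (s *\<^sub>R z) v (defect x0 n (s *\<^sub>R z) z))"
  let ?B = "2 * c * norm z * (c * norm x0 * (4 * c * norm z) ^ n / fact n) * norm v"
  have "norm (integral {0..1} ?g) \<le> ?B / (real n + 1)"
  proof (rule norm_integral_le_power)
    show "continuous_on {0..1} ?g"
      by (intro continuous_intros radial_continuous defect_continuous)
    fix s :: real assume s: "s \<in> {0..1}"
    with Suc.prems have sz: "norm (s *\<^sub>R z) \<le> R" by (auto intro: order_trans[OF mult_left_le_one_le])
    have *: "norm (\<Gamma> (s *\<^sub>R z) a (defect x0 n (s *\<^sub>R z) b)) \<le>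
        (c * norm a) * (c * norm x0 * (4 * c * norm (s *\<^sub>R z)) ^ n / fact n * norm b)" for a b
      using \<open>c > 0\<close> by (intro order_trans[OF norm_blinfun] mult_mono c sz Suc.IH) auto
    have "norm (?g s) \<le> 1 * norm (\<Gamma> (s *\<^sub>R z) z (defect x0 n (s *\<^sub>R z) v) - \<Gamma> (s *\<^sub>R z) v (defect x0 n (s *\<^sub>R z) z))"
      unfolding norm_scaleR using s by (intro mult_right_mono) auto
    also have "\<dots> \<le> (c * norm z) * (c * norm x0 * (4 * c * norm (s *\<^sub>R z)) ^ n / fact n * norm v) +
        (c * norm v) * (c * norm x0 * (4 * c * norm (s *\<^sub>R z)) ^ n / fact n * norm z)"
      unfolding mult_1 by (rule order_trans[OF norm_triangle_ineq4 add_mono[OF * *]])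
    also have "\<dots> = ?B * s ^ n"
      using s by (simp add: power_mult_distrib mult_ac)
    finally show "norm (?g s) \<le> ?B * s ^ n" .
  qed
  also have "?B / (real n + 1) = ?C / 2"
    by (simp add: divide_simps)
  finally have 2: "norm (integral {0..1} ?g) \<le> ?C / 2" .
  show ?case
    unfolding defect_Suc using norm_triangle_le[OF add_mono[OF 1 2]] by (simp only: field_sum_of_halves)
qed

text \<open>On each ball the iterates converge uniformly, and by the defect bound so do their derivatives,
  to \<open>\<Gamma> X\<close>. Since the iterates are globally defined, the limits on different balls agree.\<close>

theorem parallel_exists:
  obtains X where "parallel X" "X 0 = x0"
proof
  define X where "X z = lim (\<lambda>n. picard x0 n z)" for z
  show "X 0 = x0"
  proof -
    have "picard x0 n 0 = x0" for n
      by (induction n) (simp_all add: linear_0[OF lin])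
    then show ?thesis by (simp add: X_def)
  qed
  show "parallel X"
    unfolding parallel_def
  proof
    fix z :: 'a
    define R where "R = norm z + 1"
    obtain c where "c > 0" and c: "\<And>z v. norm z \<le> R \<Longrightarrow> norm (\<Gamma> z v) \<le> c * norm v"
      by (rule locally_bounded[of R], rule that)
    have summable_M: "summable (\<lambda>n. norm x0 * ((c * R) ^ Suc n / fact (Suc n)))"
      using summable_exp[of "c * R"]
      by (intro summable_mult) (subst summable_Suc_iff, simp add: divide_inverse mult.commute)
    have "norm (picard x0 (Suc n) y - picard x0 n y) \<le> norm x0 * ((c * R) ^ Suc n / fact (Suc n))"
      if "y \<in> cball 0 R" for n y
    proof -
      have "norm x0 * (c * norm y) ^ Suc n / fact (Suc n) \<le> norm x0 * (c * R) ^ Suc n / fact (Suc n)"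
        using that \<open>c > 0\<close>
        by (intro divide_right_mono mult_left_mono power_mono) (auto simp: mem_cball)
      with picard_increment[of c R y x0 n, OF \<open>c > 0\<close> c] that show ?thesis
        by (simp add: mem_cball del: picard.simps fact_Suc power_Suc)
    qed
    from Weierstrass_m_test[where f = "\<lambda>n y. picard x0 (Suc n) y - picard x0 n y", where A = "cball 0 R", OF this summable_M]
    have "uniform_limit (cball 0 R) (\<lambda>n y. picard x0 n y - x0)
        (\<lambda>y. \<Sum>i. picard x0 (Suc i) y - picard x0 i y) sequentially"
      by (simp add: sum_lessThan_telescope[where f = "\<lambda>n. picard x0 n _"] del: picard.simps(2))
    from uniform_limit_add[OF this uniform_limit_const[where c = "\<lambda>_. x0"]]
    obtain X' where X': "uniform_limit (cball 0 R) (picard x0) X' sequentially" by auto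
    have lim_X: "(\<lambda>n. picard x0 n y) \<longlonglongrightarrow> X y" and "X' y = X y" if "y \<in> cball 0 R" for y
      using tendsto_uniform_limitI[OF X' that] by (auto simp: X_def limI)
    then have unif: "uniform_limit (cball 0 R) (picard x0) X sequentially"
      using uniform_limit_cong'[of "cball 0 R" "picard x0" "picard x0" X' X] X' by auto
    \<comment> \<open>\<open>dX\<^sub>n - \<Gamma> X\<close> splits into the defect of \<open>X\<^sub>n\<close> and \<open>\<Gamma> (X\<^sub>n - X)\<close>\<close>
    have "\<exists>g. \<forall>y\<in>cball 0 R. (\<lambda>n. picard x0 n y) \<longlonglongrightarrow> g y \<and>
        (g has_derivative (\<lambda>v. \<Gamma> y v (X y))) (at y within cball 0 R)"
    proof (rule has_derivative_sequence[where f' = "\<lambda>n. deriv_along (picard x0 n)"])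
      show "(picard x0 n has_derivative deriv_along (picard x0 n) y) (at y within cball 0 R)" for n y
        by (rule has_derivative_at_withinI[OF C1_has_derivative[OF picard_C1]])
      show "z \<in> cball 0 R" "(\<lambda>n. picard x0 n z) \<longlonglongrightarrow> X z"
        using lim_X[of z] by (auto simp: R_def mem_cball)
      fix e :: real assume "e > 0"
      have "(\<lambda>n. c * norm x0 * ((4 * c * R) ^ n / fact n)) \<longlonglongrightarrow> c * norm x0 * 0"
        using summable_LIMSEQ_zero[OF summable_exp[of "4 * c * R"]]
        by (intro tendsto_mult_left) (simp add: divide_inverse mult.commute)
      then have "\<forall>\<^sub>F n in sequentially. c * norm x0 * ((4 * c * R) ^ n / fact n) < e / 2"
        using \<open>e > 0\<close> by (auto dest!: order_tendstoD(2)[where a = "e / 2"])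
      moreover have "\<forall>\<^sub>F n in sequentially. \<forall>y\<in>cball 0 R. dist (picard x0 n y) (X y) < e / (2 * c)"
        using uniform_limitD[OF unif] \<open>e > 0\<close> \<open>c > 0\<close> by simp
      ultimately show "\<forall>\<^sub>F n in sequentially. \<forall>y\<in>cball 0 R. \<forall>h.
          norm (deriv_along (picard x0 n) y h - \<Gamma> y h (X y)) \<le> e * norm h"
      proof eventually_elim
        case (elim n)
        show ?case
        proof (intro ballI allI)
          fix y h :: 'a assume y: "y \<in> cball 0 R"
          then have yR: "norm y \<le> R" by (simp add: mem_cball)
          have "norm (defect x0 n y h) \<le> c * norm x0 * (4 * c * norm y) ^ n / fact n * norm h"
            by (rule defect_bound[OF \<open>c > 0\<close> c yR])
          also have "\<dots> \<le> c * norm x0 * (4 * c * R) ^ n / fact n * norm h"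
            using \<open>c > 0\<close> yR by (intro mult_right_mono divide_right_mono mult_left_mono power_mono) auto
          also have "\<dots> \<le> e / 2 * norm h"
            using elim(1) by (intro mult_right_mono) auto
          finally have 1: "norm (defect x0 n y h) \<le> e / 2 * norm h" .
          have "norm (\<Gamma> y h (picard x0 n y - X y)) \<le> norm (\<Gamma> y h) * norm (picard x0 n y - X y)"
            by (rule norm_blinfun)
          also have "\<dots> \<le> (c * norm h) * (e / (2 * c))"
            using elim(2) y yR \<open>c > 0\<close> by (intro mult_mono c) (auto simp: dist_norm less_imp_le)
          also have "\<dots> = e / 2 * norm h" using \<open>c > 0\<close> by simp
          finally have 2: "norm (\<Gamma> y h (picard x0 n y - X y)) \<le> e / 2 * norm h" .
          have "deriv_along (picard x0 n) y h - \<Gamma> y h (X y) = defect x0 n y h + \<Gamma> y h (picard x0 n y - X y)"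
            by (simp add: defect_def blinfun.diff_right)
          with norm_triangle_le[OF add_mono[OF 1 2]]
          show "norm (deriv_along (picard x0 n) y h - \<Gamma> y h (X y)) \<le> e * norm h" by simp
        qed
      qed
    qed simp
    then obtain g where g: "\<And>y. y \<in> cball 0 R \<Longrightarrow> (\<lambda>n. picard x0 n y) \<longlonglongrightarrow> g y"
        "\<And>y. y \<in> cball 0 R \<Longrightarrow> (g has_derivative (\<lambda>v. \<Gamma> y v (X y))) (at y within cball 0 R)"
      by blast
    have z: "z \<in> interior (cball 0 R)" "z \<in> ball 0 R" by (auto simp: R_def)
    have "(g has_derivative (\<lambda>v. \<Gamma> z v (X z))) (at z)"
      using g(2)[of z] z at_within_interior[OF z(1)] by auto
    moreover have "g y = X y" if "y \<in> ball 0 R" for y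
      by (rule LIMSEQ_unique[OF g(1) lim_X]) (use that in auto)
    ultimately show "(X has_derivative (\<lambda>v. \<Gamma> z v (X z))) (at z)"
      using has_derivative_transform_within_open[OF _ open_ball z(2)] by blast
  qed
qed

end

section \<open>Partial derivatives in space-time\<close>

definition coord :: "'d::finite option \<Rightarrow> 'd spacetime \<Rightarrow> real" where
  "coord \<alpha> v = (case \<alpha> of None \<Rightarrow> fst v | Some k \<Rightarrow> snd v $ k)"

lemma coord_linear: "linear (coord \<alpha>)"
  by (rule linearI) (auto simp: coord_def split: option.splits)

lemma coord_dir: "coord \<alpha> (dir \<beta>) = (if \<alpha> = \<beta> then 1 else 0)"
  by (auto simp: coord_def dir_def axis_def split: option.splits)

lemma coord_expand: "v = (\<Sum>\<alpha>\<in>UNIV. coord \<alpha> v *\<^sub>R dir \<alpha>)"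
proof -
  have "(\<Sum>\<alpha>\<in>UNIV. coord \<alpha> v *\<^sub>R dir \<alpha>) = (fst v, 0) + (\<Sum>k\<in>UNIV. (0, (snd v $ k) *\<^sub>R axis k 1))"
    by (simp add: UNIV_option_conv sum.reindex coord_def dir_def scaleR_prod_def)
  also have "\<dots> = (fst v, \<Sum>k\<in>UNIV. (snd v $ k) *\<^sub>R axis k 1)"
    by (simp add: prod_eq_iff fst_sum snd_sum)
  also have "(\<Sum>k\<in>UNIV. (snd v $ k) *\<^sub>R axis k (1::real)) = snd v"
    by (simp add: vec_eq_iff axis_def if_distrib cong: if_cong)
  finally show ?thesis by simp
qed

lemma linear_coord_expand: "linear L \<Longrightarrow> L v = (\<Sum>\<alpha>\<in>UNIV. coord \<alpha> v *\<^sub>R L (dir \<alpha>))"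
  by (subst coord_expand) (simp add: linear_sum linear_scale)

lemma partial_eq:
  assumes "(f has_derivative f') (at z)"
  shows "partial \<alpha> f z = f' (dir \<alpha>)"
  unfolding partial_def
proof (rule vector_derivative_at)
  have "((\<lambda>s. f (z + s *\<^sub>R dir \<alpha>)) has_derivative (\<lambda>h. f' (h *\<^sub>R dir \<alpha>))) (at 0)"
    by (rule has_derivative_compose[where f = "\<lambda>s. z + s *\<^sub>R dir \<alpha>" and g = f])
      (use assms in \<open>auto intro!: derivative_eq_intros\<close>)
  then show "((\<lambda>s. f (z + s *\<^sub>R dir \<alpha>)) has_vector_derivative f' (dir \<alpha>)) (at 0)"
    by (simp add: has_vector_derivative_def linear_scale[OF has_derivative_linear[OF assms]])
qed

lemma smooth_has_derivative: "smooth f \<Longrightarrow> (f has_derivative deriv_along f z) (at z)"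
  unfolding smooth_def by (blast intro: times_differentiable_has_derivative)

lemma partial_smooth_eq: "smooth f \<Longrightarrow> partial \<alpha> f z = deriv_along f z (dir \<alpha>)"
  by (rule partial_eq[OF smooth_has_derivative])

text \<open>Passes from a system for the partial derivatives to the total derivative of a parallel section.\<close>

lemma deriv_along_eq_partial:
  "smooth f \<Longrightarrow> deriv_along f z v = (\<Sum>\<alpha>\<in>UNIV. coord \<alpha> v *\<^sub>R partial \<alpha> f z)"
  using linear_coord_expand[OF has_derivative_linear[OF smooth_has_derivative]]
  by (simp add: partial_smooth_eq)

lemma smooth_partial: assumes "smooth f" shows "smooth (partial \<alpha> f)"
proof -
  have "partial \<alpha> f = (\<lambda>z. deriv_along f z (dir \<alpha>))"
    using partial_smooth_eq[OF assms] by auto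
  then show ?thesis
    using assms by (metis smooth_def times_differentiable_deriv)
qed

lemma smooth_bounded_linear: "bounded_linear h \<Longrightarrow> smooth f \<Longrightarrow> smooth (\<lambda>z. h (f z))"
  by (simp add: smooth_def times_differentiable_bounded_linear)

lemma smooth_bilinear: "bounded_bilinear p \<Longrightarrow> smooth f \<Longrightarrow> smooth g \<Longrightarrow> smooth (\<lambda>z. p (f z) (g z))"
  by (simp add: smooth_def times_differentiable_bilinear)

lemma smooth_add: "smooth f \<Longrightarrow> smooth g \<Longrightarrow> smooth (\<lambda>z. f z + g z)"
  by (simp add: smooth_def times_differentiable_add)

lemma smooth_sum: "(\<And>i. i \<in> I \<Longrightarrow> smooth (f i)) \<Longrightarrow> smooth (\<lambda>z. \<Sum>i\<in>I. f i z)"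
  by (simp add: smooth_def times_differentiable_sum)

lemma smooth_Pair: "smooth f \<Longrightarrow> smooth g \<Longrightarrow> smooth (\<lambda>z. (f z, g z))"
  by (simp add: smooth_def times_differentiable_Pair)

lemma partial_commute: "smooth f \<Longrightarrow> partial \<alpha> (partial \<beta> f) z = partial \<beta> (partial \<alpha> f) z"
  for f :: "'d::finite spacetime \<Rightarrow> 'b::banach"
proof -
  assume f: "smooth f"
  have "partial \<gamma> f = (\<lambda>z. deriv_along f z (dir \<gamma>))" for \<gamma>
    using partial_smooth_eq[OF f] by auto
  then show ?thesis
    using symmetric_second_derivative[of f "dir \<beta>" z "dir \<alpha>"] f partial_smooth_eq[OF smooth_partial[OF f]]
    by (simp add: smooth_def)
qed

lemma partial_bounded_linear:
  assumes "bounded_linear h" "smooth f"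
  shows "partial \<alpha> (\<lambda>z. h (f z)) z = h (partial \<alpha> f z)"
  unfolding partial_smooth_eq[OF assms(2)]
  by (rule partial_eq[OF bounded_linear.has_derivative[OF assms(1) smooth_has_derivative[OF assms(2)]]])

lemma partial_bilinear:
  assumes "bounded_bilinear p" "smooth f" "smooth g"
  shows "partial \<alpha> (\<lambda>z. p (f z) (g z)) z = p (f z) (partial \<alpha> g z) + p (partial \<alpha> f z) (g z)"
  unfolding partial_smooth_eq[OF assms(2)] partial_smooth_eq[OF assms(3)]
  by (rule partial_eq[OF bounded_bilinear.FDERIV[OF assms(1) smooth_has_derivative[OF assms(2)]
        smooth_has_derivative[OF assms(3)]]])

lemma partial_add:
  assumes "smooth f" "smooth g"
  shows "partial \<alpha> (\<lambda>z. f z + g z) z = partial \<alpha> f z + partial \<alpha> g z"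
  unfolding partial_smooth_eq[OF assms(1)] partial_smooth_eq[OF assms(2)]
  by (rule partial_eq[OF has_derivative_add[OF smooth_has_derivative[OF assms(1)]
        smooth_has_derivative[OF assms(2)]]])

lemma partial_sum:
  assumes "\<And>i. i \<in> I \<Longrightarrow> smooth (f i)"
  shows "partial \<alpha> (\<lambda>z. \<Sum>i\<in>I. f i z) z = (\<Sum>i\<in>I. partial \<alpha> (f i) z)"
proof -
  have "partial \<alpha> (\<lambda>z. \<Sum>i\<in>I. f i z) z = (\<Sum>i\<in>I. deriv_along (f i) z (dir \<alpha>))"
    by (rule partial_eq, rule has_derivative_sum) (rule smooth_has_derivative[OF assms])
  then show ?thesis by (simp add: partial_smooth_eq assms)
qed

lemma partial_Pair:
  assumes "smooth f" "smooth g"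
  shows "partial \<alpha> (\<lambda>z. (f z, g z)) z = (partial \<alpha> f z, partial \<alpha> g z)"
  unfolding partial_smooth_eq[OF assms(1)] partial_smooth_eq[OF assms(2)]
  by (rule partial_eq[OF has_derivative_Pair[OF smooth_has_derivative[OF assms(1)]
        smooth_has_derivative[OF assms(2)]]])

section \<open>The gauge equations for all space-time indices\<close>

lemma smooth_gauge_term:
  assumes "smooth (a \<beta>)" "smooth f"
  shows "smooth (\<lambda>z. \<i> * of_real (a \<beta> z) * f z)"
  by (intro smooth_bilinear[OF bounded_bilinear_mult] smooth_bounded_linear[OF bounded_linear_mult_right]
      smooth_bounded_linear[OF bounded_linear_of_real] assms)

lemma smooth_gauge_deriv:
  assumes "smooth (a \<beta>)" "smooth f"
  shows "smooth (gauge_deriv a \<beta> f)"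
  unfolding gauge_deriv_def[abs_def]
  by (intro smooth_add smooth_partial smooth_gauge_term assms)

lemma gauge_deriv_gauge_deriv:
  assumes a: "smooth (a \<beta>)" and f: "smooth f"
  shows "gauge_deriv a \<alpha> (gauge_deriv a \<beta> f) z = partial \<alpha> (partial \<beta> f) z
    + \<i> * (of_real (partial \<alpha> (a \<beta>) z) * f z + of_real (a \<beta> z) * partial \<alpha> f z
      + of_real (a \<alpha> z) * partial \<beta> f z) - of_real (a \<alpha> z * a \<beta> z) * f z"
proof -
  note sm = smooth_bounded_linear[OF bounded_linear_mult_right] smooth_bounded_linear[OF bounded_linear_of_real]
  have "partial \<alpha> (gauge_deriv a \<beta> f) z = partial \<alpha> (partial \<beta> f) z +
      (\<i> * of_real (a \<beta> z) * partial \<alpha> f z + \<i> * of_real (partial \<alpha> (a \<beta>) z) * f z)"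
    unfolding gauge_deriv_def[abs_def] partial_add[OF smooth_partial[OF f] smooth_gauge_term[where a = a, OF a f]]
    by (subst partial_bilinear[OF bounded_bilinear_mult sm(1)[OF sm(2)[OF a]] f],
        subst partial_bounded_linear[OF bounded_linear_mult_right sm(2)[OF a]],
        subst partial_bounded_linear[OF bounded_linear_of_real a]) simp
  then show ?thesis
    by (simp add: gauge_deriv_def[of a \<alpha>] gauge_deriv_def[of a \<beta> f z] algebra_simps)
qed

text \<open>The second-order terms cancel by symmetry of second derivatives, the first-order terms and the term
  quadratic in the potential are symmetric, and only the field strength remains.\<close>

lemma gauge_deriv_commutator:
  assumes a: "smooth (a \<alpha>)" "smooth (a \<beta>)" and f: "smooth f"
  shows "gauge_deriv a \<alpha> (gauge_deriv a \<beta> f) z - gauge_deriv a \<beta> (gauge_deriv a \<alpha> f) z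
    = \<i> * of_real (partial \<alpha> (a \<beta>) z - partial \<beta> (a \<alpha>) z) * f z"
  unfolding gauge_deriv_gauge_deriv[of a, OF a(1) f] gauge_deriv_gauge_deriv[of a, OF a(2) f]
    partial_commute[OF f, of \<alpha> \<beta>]
  by (simp add: algebra_simps)

lemma smooth_with_time:
  assumes "\<And>l. smooth (q l)" "\<And>\<alpha>. smooth (a \<alpha>)"
  shows "smooth (with_time a q \<alpha>)"
proof (cases \<alpha>)
  case None
  have "smooth (\<lambda>z. \<i> * (\<Sum>j\<in>UNIV. gauge_deriv a (Some j) (q j) z))"
    by (intro smooth_bounded_linear[OF bounded_linear_mult_right] smooth_sum smooth_gauge_deriv assms)
  with None show ?thesis by (simp add: with_time_def)
qed (simp add: with_time_def assms)

text \<open>\<open>D\<^sub>\<ell> q\<^sub>0 = \<i> D\<^sub>\<ell> D\<^sub>k q\<^sub>k\<close>, while the evolution equation contains \<open>\<i> D\<^sub>k D\<^sub>k q\<^sub>\<ell> = \<i> D\<^sub>k D\<^sub>\<ell> q\<^sub>k\<close>. The commutator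
  \<open>D\<^sub>k D\<^sub>\<ell> - D\<^sub>\<ell> D\<^sub>k\<close> is multiplication by \<open>\<i> \<langle>q\<^sub>\<ell>, \<i> q\<^sub>k\<rangle>\<close>, and with the factor \<open>\<i>\<close> in front it cancels the cubic term
  of the evolution equation.\<close>

lemma time_compatibility:
  fixes q :: "'d::finite \<Rightarrow> 'd spacetime \<Rightarrow> complex"
  assumes q: "\<And>l. smooth (q l)" and a: "\<And>\<alpha>. smooth (a \<alpha>)"
    and evolution: "\<And>l z. gauge_deriv a None (q l) z =
        \<i> * (\<Sum>k\<in>UNIV. gauge_deriv a (Some k) (gauge_deriv a (Some k) (q l)) z)
        + (\<Sum>k\<in>UNIV. of_real (q l z \<bullet> (\<i> * q k z)) * q k z)"
    and compatibility: "\<And>l k z. gauge_deriv a (Some l) (q k) z = gauge_deriv a (Some k) (q l) z"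
    and curvature: "\<And>l j z. partial (Some l) (a (Some j)) z - partial (Some j) (a (Some l)) z
        = - (q l z \<bullet> (\<i> * q j z))"
  shows "gauge_deriv a None (q l) z = gauge_deriv a (Some l) (with_time a q None) z"
proof -
  let ?G = "\<lambda>k. gauge_deriv a (Some k)"
  note sm = smooth_gauge_deriv[of a, OF a q]
  have "?G k (?G k (q l)) z = ?G l (?G k (q k)) z + \<i> * of_real (q l z \<bullet> (\<i> * q k z)) * q k z" for k
  proof -
    have "?G k (q l) = ?G l (q k)"
      using compatibility by blast
    moreover have "partial (Some k) (a (Some l)) z - partial (Some l) (a (Some k)) z = q l z \<bullet> (\<i> * q k z)"
      using curvature[of l k z] by simp
    ultimately show ?thesis
      using gauge_deriv_commutator[of a "Some k" "Some l" "q k" z, OF a a q]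
      by (simp add: diff_eq_eq add.commute)
  qed
  then have 1: "gauge_deriv a None (q l) z = \<i> * (\<Sum>k\<in>UNIV. ?G l (?G k (q k)) z)"
    by (simp add: evolution sum.distrib sum_distrib_left sum_negf algebra_simps)
  have "partial (Some l) (with_time a q None) z = \<i> * (\<Sum>j\<in>UNIV. partial (Some l) (?G j (q j)) z)"
    by (simp add: with_time_def partial_bounded_linear[OF bounded_linear_mult_right smooth_sum[OF sm]]
        partial_sum[OF sm])
  then have "?G l (with_time a q None) z = \<i> * (\<Sum>k\<in>UNIV. ?G l (?G k (q k)) z)"
    unfolding gauge_deriv_def[of a "Some l" "with_time a q None"] gauge_deriv_def[of a "Some l" "?G _ _"]
    by (simp add: with_time_def sum.distrib sum_distrib_left algebra_simps)
  with 1 show ?thesis by simp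
qed

section \<open>Minkowski algebra of moving frames\<close>

lemma eta_linear: "linear eta"
  by (rule linearI) (simp_all add: eta_def vec_eq_iff forall_3 algebra_simps)

lemma bounded_linear_eta: "bounded_linear eta"
  using eta_linear linear_conv_bounded_linear by blast

lemma bounded_bilinear_cross3: "bounded_bilinear cross3"
  using bilinear_cross bilinear_conv_bounded_bilinear by blast

lemma eta_eta [simp]: "eta (eta v) = v"
  by (simp add: eta_def vec_eq_iff forall_3)

lemma eta_inner_commute: "eta v \<bullet> w = v \<bullet> eta w"
  by (simp add: eta_def inner_vec_def sum_3)

lemma eta_cross_eta: "eta (cross3 (eta v) (eta w)) = - cross3 v w"
  by (simp add: eta_def cross3_def vec_eq_iff forall_3)

lemmas eta_simps = linear_add[OF eta_linear] linear_diff[OF eta_linear] linear_neg[OF eta_linear]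
  linear_scale[OF eta_linear] linear_0[OF eta_linear]

lemma hyperbolic_plane_iff: "u \<in> hyperbolic_plane \<longleftrightarrow> eta u \<bullet> u = -1 \<and> u $ 1 > 0"
  by (simp add: hyperbolic_plane_def eta_def inner_vec_def sum_3 power2_eq_square)

lemma hnorm_eq_1: "hnorm v = 1 \<longleftrightarrow> eta v \<bullet> v = 1"
  by (simp add: hnorm_def inner_commute)

text \<open>Since \<open>\<eta>\<close> is an involution of determinant \<open>-1\<close>, \<open>J u e\<close> is \<open>- (\<eta> u \<times> \<eta> e)\<close>, and both identities become
  instances of the triple product expansion.\<close>

lemma J_frame:
  assumes "eta u \<bullet> u = -1" "eta u \<bullet> e = 0" "eta e \<bullet> e = 1"
  shows "eta (cross3 (J u e) e) = u" "eta (cross3 u (J u e)) = - e"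
proof -
  have eqs: "e \<bullet> eta e = 1" "e \<bullet> eta u = 0" "u \<bullet> eta e = 0" "u \<bullet> eta u = - 1"
    using assms eta_inner_commute[of u e] by (simp_all add: inner_commute)
  have J: "J u e = - cross3 (eta u) (eta e)"
    unfolding J_def by (metis eta_cross_eta eta_eta)
  have "cross3 (J u e) e = eta u"
  proof -
    have "cross3 (J u e) e = cross3 e (cross3 (eta u) (eta e))"
      unfolding J by (metis cross_minus_left cross_skew minus_minus)
    also have "\<dots> = eta u"
      by (simp add: Lagrange eqs)
    finally show ?thesis .
  qed
  then show "eta (cross3 (J u e) e) = u" by simp
  have "cross3 u (J u e) = - cross3 u (cross3 (eta u) (eta e))"
    unfolding J by simp
  also have "\<dots> = - eta e"
    by (simp add: Lagrange eqs)
  finally show "eta (cross3 u (J u e)) = - e" by (simp add: eta_simps)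
qed

type_synonym triad = "(real^3) \<times> (real^3) \<times> (real^3)"

text \<open>The matrix in the Lie algebra of \<open>SO(2,1)\<close> that moves a triad \<open>(u, e, J e)\<close> when the base point has
  velocity \<open>w\<close> in the frame and the frame rotates at rate \<open>r\<close>. The \<open>u\<close>-components of the second and third
  entry are the normal parts that the covariant derivative on the hyperbolic plane subtracts.\<close>

definition frame_op :: "complex \<Rightarrow> real \<Rightarrow> triad \<Rightarrow>\<^sub>L triad" where
  "frame_op w r = Blinfun (\<lambda>(u, e, f). (Re w *\<^sub>R e + Im w *\<^sub>R f, Re w *\<^sub>R u + r *\<^sub>R f, Im w *\<^sub>R u - r *\<^sub>R e))"

lemma frame_op_apply [simp]:
  "frame_op w r (u, e, f) = (Re w *\<^sub>R e + Im w *\<^sub>R f, Re w *\<^sub>R u + r *\<^sub>R f, Im w *\<^sub>R u - r *\<^sub>R e)"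
proof -
  have "linear (\<lambda>(u, e, f). (Re w *\<^sub>R e + Im w *\<^sub>R f, Re w *\<^sub>R u + r *\<^sub>R f, Im w *\<^sub>R u - r *\<^sub>R e) :: triad)"
    by (rule linearI) (auto simp: algebra_simps)
  then have "bounded_linear (\<lambda>(u, e, f). (Re w *\<^sub>R e + Im w *\<^sub>R f, Re w *\<^sub>R u + r *\<^sub>R f, Im w *\<^sub>R u - r *\<^sub>R e) :: triad)"
    using linear_conv_bounded_linear by blast
  then show ?thesis by (simp add: frame_op_def bounded_linear_Blinfun_apply)
qed

lemma bounded_linear_frame_op: "bounded_linear (\<lambda>p. frame_op (fst p) (snd p))"
proof -
  have "linear (\<lambda>p. frame_op (fst p) (snd p))"
    by (rule linearI)
      (auto intro!: blinfun_eqI simp: blinfun.bilinear_simps algebra_simps)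
  then show ?thesis using linear_conv_bounded_linear by blast
qed

text \<open>The \<open>u\<close>-column of the zero-curvature equation is \<open>D\<^sub>\<alpha> q\<^sub>\<beta> = D\<^sub>\<beta> q\<^sub>\<alpha>\<close>; the \<open>e\<close>-\<open>f\<close> entry is the equation for the
  field strength. In the names, \<open>d\<alpha>q\<beta>\<close> stands for \<open>\<partial>\<^sub>\<alpha> q\<^sub>\<beta>\<close>.\<close>

lemma frame_op_zero_curvature:
  assumes "d\<alpha>q\<beta> + \<i> * of_real a\<alpha> * q\<beta> = d\<beta>q\<alpha> + \<i> * of_real a\<beta> * q\<alpha>"
    and "d\<alpha>a\<beta> - d\<beta>a\<alpha> = - (q\<alpha> \<bullet> (\<i> * q\<beta>))"
  shows "frame_op d\<alpha>q\<beta> d\<alpha>a\<beta> x + frame_op q\<beta> a\<beta> (frame_op q\<alpha> a\<alpha> x) =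
    frame_op d\<beta>q\<alpha> d\<beta>a\<alpha> x + frame_op q\<alpha> a\<alpha> (frame_op q\<beta> a\<beta> x)"
proof -
  obtain u e f where x: "x = (u, e, f)" by (cases x) auto
  have 1: "Re d\<alpha>q\<beta> = Re d\<beta>q\<alpha> - a\<beta> * Im q\<alpha> + a\<alpha> * Im q\<beta>"
    and 2: "Im d\<alpha>q\<beta> = Im d\<beta>q\<alpha> + a\<beta> * Re q\<alpha> - a\<alpha> * Re q\<beta>"
    using assms(1) by (auto simp: complex_eq_iff)
  have 3: "d\<alpha>a\<beta> = d\<beta>a\<alpha> + Re q\<alpha> * Im q\<beta> - Im q\<alpha> * Re q\<beta>"
    using assms(2) by (simp add: inner_complex_def)
  show ?thesis
    unfolding x frame_op_apply 1 2 3 by (simp add: algebra_simps)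
qed

section \<open>The connection of moving triads\<close>

definition triad_connection :: "('d::finite option \<Rightarrow> 'd spacetime \<Rightarrow> complex) \<Rightarrow>
    ('d option \<Rightarrow> 'd spacetime \<Rightarrow> real) \<Rightarrow> 'd spacetime \<Rightarrow> 'd spacetime \<Rightarrow> triad \<Rightarrow>\<^sub>L triad" where
  "triad_connection Q a z v = (\<Sum>\<alpha>\<in>UNIV. coord \<alpha> v *\<^sub>R frame_op (Q \<alpha> z) (a \<alpha> z))"

lemma smooth_frame_op:
  "smooth g \<Longrightarrow> smooth h \<Longrightarrow> smooth (\<lambda>z. frame_op (g z) (h z))"
  using smooth_bounded_linear[OF bounded_linear_frame_op smooth_Pair] by simp

lemma deriv_along_frame_op:
  assumes "smooth g" "smooth h"
  shows "deriv_along (\<lambda>z. frame_op (g z) (h z)) z w =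
    (\<Sum>\<beta>\<in>UNIV. coord \<beta> w *\<^sub>R frame_op (partial \<beta> g z) (partial \<beta> h z))"
  using partial_bounded_linear[OF bounded_linear_frame_op smooth_Pair[OF assms]]
  by (simp add: deriv_along_eq_partial[OF smooth_frame_op[OF assms]] partial_Pair[OF assms])

lemma triad_connection_dir: "triad_connection Q a z (dir \<alpha>) = frame_op (Q \<alpha> z) (a \<alpha> z)"
  by (simp add: triad_connection_def coord_dir if_distrib[of "\<lambda>c. c *\<^sub>R _"] cong: if_cong)

lemma linear_triad_connection: "linear (triad_connection Q a z)"
  unfolding triad_connection_def
  by (rule linearI)
    (simp_all add: linear_add[OF coord_linear] linear_scale[OF coord_linear] scaleR_left_distrib
      sum.distrib scaleR_sum_right)

lemma smooth_triad_connection: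
  "(\<And>\<alpha>. smooth (Q \<alpha>)) \<Longrightarrow> (\<And>\<alpha>. smooth (a \<alpha>)) \<Longrightarrow> smooth (\<lambda>z. triad_connection Q a z v)"
  unfolding triad_connection_def
  by (intro smooth_sum smooth_bounded_linear[OF bounded_linear_scaleR_right] smooth_frame_op)

text \<open>Both sides of the flatness equation are bilinear in the two directions, so it suffices that their
  coefficients with respect to the coordinate directions are symmetric.\<close>

lemma flat_triad_connection:
  fixes Q :: "'d::finite option \<Rightarrow> 'd spacetime \<Rightarrow> complex"
  assumes Q: "\<And>\<alpha>. smooth (Q \<alpha>)" and a: "\<And>\<alpha>. smooth (a \<alpha>)"
    and compat: "\<And>\<alpha> \<beta> z. gauge_deriv a \<alpha> (Q \<beta>) z = gauge_deriv a \<beta> (Q \<alpha>) z"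
    and curv: "\<And>\<alpha> \<beta> z. partial \<alpha> (a \<beta>) z - partial \<beta> (a \<alpha>) z = - (Q \<alpha> z \<bullet> (\<i> * Q \<beta> z))"
  shows "flat_connection (triad_connection Q a)"
proof (intro flat_connection.intro linear_connection.intro flat_connection_axioms.intro)
  show "linear (triad_connection Q a z)" for z
    by (rule linear_triad_connection)
  show "times_differentiable 1 (\<lambda>z. triad_connection Q a z v)" for v
    using smooth_triad_connection[of Q a v, OF Q a] unfolding smooth_def by blast
  fix z v w :: "'d spacetime" and x :: triad
  define T where "T \<alpha> \<beta> = frame_op (partial \<beta> (Q \<alpha>) z) (partial \<beta> (a \<alpha>) z) x +
    frame_op (Q \<alpha> z) (a \<alpha> z) (frame_op (Q \<beta> z) (a \<beta> z) x)" for \<alpha> \<beta>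
  have T_sym: "T \<alpha> \<beta> = T \<beta> \<alpha>" for \<alpha> \<beta>
    unfolding T_def
    by (rule frame_op_zero_curvature) (use compat curv in \<open>simp_all add: gauge_deriv_def\<close>)
  have main: "blinfun_apply (deriv_along (\<lambda>y. triad_connection Q a y v) z w) x +
      triad_connection Q a z v (triad_connection Q a z w x) =
      (\<Sum>\<alpha>\<in>UNIV. \<Sum>\<beta>\<in>UNIV. (coord \<alpha> v * coord \<beta> w) *\<^sub>R T \<alpha> \<beta>)" for v w
  proof -
    have "deriv_along (\<lambda>y. triad_connection Q a y v) z w =
        (\<Sum>\<alpha>\<in>UNIV. coord \<alpha> v *\<^sub>R deriv_along (\<lambda>y. frame_op (Q \<alpha> y) (a \<alpha> y)) z w)"
      unfolding triad_connection_def
      by (intro deriv_along_unique has_derivative_sum has_derivative_scaleR_right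
          smooth_has_derivative smooth_frame_op Q a)
    then have "blinfun_apply (deriv_along (\<lambda>y. triad_connection Q a y v) z w) x =
        (\<Sum>\<alpha>\<in>UNIV. \<Sum>\<beta>\<in>UNIV. (coord \<alpha> v * coord \<beta> w) *\<^sub>R
          blinfun_apply (frame_op (partial \<beta> (Q \<alpha>) z) (partial \<beta> (a \<alpha>) z)) x)"
      by (simp add: deriv_along_frame_op[OF Q a] blinfun.sum_left blinfun.scaleR_left scaleR_sum_right)
    moreover have "triad_connection Q a z v (triad_connection Q a z w x) =
        (\<Sum>\<alpha>\<in>UNIV. \<Sum>\<beta>\<in>UNIV. (coord \<alpha> v * coord \<beta> w) *\<^sub>R
          frame_op (Q \<alpha> z) (a \<alpha> z) (frame_op (Q \<beta> z) (a \<beta> z) x))"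
      by (simp add: triad_connection_def blinfun.sum_left blinfun.scaleR_left blinfun.sum_right
          blinfun.scaleR_right scaleR_sum_right)
        (subst sum.swap, simp only: mult.commute)
    ultimately show ?thesis
      by (simp add: T_def scaleR_add_right sum.distrib)
  qed
  show "blinfun_apply (deriv_along (\<lambda>y. triad_connection Q a y v) z w) x +
      triad_connection Q a z v (triad_connection Q a z w x) =
      blinfun_apply (deriv_along (\<lambda>y. triad_connection Q a y w) z v) x +
      triad_connection Q a z w (triad_connection Q a z v x)"
    unfolding main by (subst sum.swap, subst T_sym) (simp only: mult.commute)
qed

definition triad_equations :: "('d::finite option \<Rightarrow> 'd spacetime \<Rightarrow> complex) \<Rightarrow>
    ('d option \<Rightarrow> 'd spacetime \<Rightarrow> real) \<Rightarrow> ('d spacetime \<Rightarrow> triad) \<Rightarrow> bool" where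
  "triad_equations Q a X \<longleftrightarrow> smooth X \<and>
    (\<forall>\<alpha> z. partial \<alpha> X z = frame_op (Q \<alpha> z) (a \<alpha> z) (X z))"

lemma triad_equations_iff_parallel:
  assumes Q: "\<And>\<alpha>. smooth (Q \<alpha>)" and a: "\<And>\<alpha>. smooth (a \<alpha>)"
  shows "triad_equations Q a X \<longleftrightarrow> linear_connection.parallel (triad_connection Q a) X"
proof -
  interpret linear_connection "triad_connection Q a"
    by (intro linear_connection.intro linear_triad_connection)
      (use smooth_triad_connection[of Q a, OF Q a] in \<open>unfold smooth_def, blast\<close>)
  show ?thesis
  proof
    assume X: "triad_equations Q a X"
    then have "smooth X" and "partial \<alpha> X z = frame_op (Q \<alpha> z) (a \<alpha> z) (X z)" for \<alpha> z
      unfolding triad_equations_def by blast+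
    then have "deriv_along X z v = triad_connection Q a z v (X z)" for z v
      by (simp add: deriv_along_eq_partial triad_connection_def blinfun.sum_left blinfun.scaleR_left)
    then show "parallel X"
      using X smooth_has_derivative[of X] unfolding parallel_def triad_equations_def
      by (metis (no_types, lifting) ext)
  next
    assume X: "parallel X"
    show "triad_equations Q a X"
      unfolding triad_equations_def
      using parallel_smooth[OF X smooth_triad_connection, OF Q a]
        partial_eq[OF parallel_has_derivative[OF X]] by (simp add: triad_connection_dir)
  qed
qed

lemma triad_equations_components:
  assumes "smooth u" "smooth e" "smooth f"
  shows "triad_equations Q a (\<lambda>z. (u z, e z, f z)) \<longleftrightarrow>
    (\<forall>\<alpha> z. partial \<alpha> u z = Re (Q \<alpha> z) *\<^sub>R e z + Im (Q \<alpha> z) *\<^sub>R f z \<and>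
      partial \<alpha> e z = Re (Q \<alpha> z) *\<^sub>R u z + a \<alpha> z *\<^sub>R f z \<and>
      partial \<alpha> f z = Im (Q \<alpha> z) *\<^sub>R u z - a \<alpha> z *\<^sub>R e z)"
  using assms by (simp add: triad_equations_def smooth_Pair partial_Pair)

section \<open>Self-dual triads as frames over the hyperbolic plane\<close>

lemma smooth_cross: "smooth v \<Longrightarrow> smooth w \<Longrightarrow> smooth (\<lambda>z. eta (cross3 (v z) (w z)))"
  by (intro smooth_bounded_linear[OF bounded_linear_eta] smooth_bilinear[OF bounded_bilinear_cross3])

lemma partial_cross:
  "smooth v \<Longrightarrow> smooth w \<Longrightarrow> partial \<alpha> (\<lambda>z. eta (cross3 (v z) (w z))) z =
    eta (cross3 (v z) (partial \<alpha> w z)) + eta (cross3 (partial \<alpha> v z) (w z))"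
  by (simp add: partial_bounded_linear[OF bounded_linear_eta smooth_bilinear[OF bounded_bilinear_cross3]]
      partial_bilinear[OF bounded_bilinear_cross3] eta_simps)

lemmas cross_eta_simps = eta_simps cross_add_left cross_add_right cross_mult_left cross_mult_right
  Cross3.left_diff_distrib Cross3.right_diff_distrib

text \<open>For a frame the dual triad is the triad itself, expressed through cross products. The Leibniz rule
  for the cross product shows that duality preserves the system, for any triad.\<close>

lemma triad_equations_dual:
  assumes sm: "smooth u" "smooth e" "smooth f"
    and X: "triad_equations Q a (\<lambda>z. (u z, e z, f z))"
  shows "triad_equations Q a
    (\<lambda>z. (eta (cross3 (f z) (e z)), eta (cross3 (f z) (u z)), eta (cross3 (u z) (e z))))"
proof -
  note X = X[unfolded triad_equations_components[OF sm], rule_format]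
  have "cross3 (e z) (u z) = - cross3 (u z) (e z)" "cross3 (u z) (f z) = - cross3 (f z) (u z)" for z
    by (rule cross_skew)+
  then show ?thesis
    by (simp add: triad_equations_components smooth_cross sm partial_cross X cross_eta_simps)
qed

text \<open>The direction used for uniqueness: every admissible pair \<open>(u, e)\<close> yields a solution of the linear
  system. The normal component of \<open>\<partial>\<^sub>\<alpha> e\<close> is \<open>Re q\<^sub>\<alpha>\<close> because \<open>e\<close> is a unit vector orthogonal to \<open>J e\<close>.\<close>

lemma frame_triad_equations:
  assumes sm: "smooth u" "smooth e"
    and u: "\<And>z. u z \<in> hyperbolic_plane" and e: "\<And>z. e z \<in> tangent_plane (u z)" "\<And>z. hnorm (e z) = 1"
    and du: "\<And>\<alpha> z. partial \<alpha> u z = frame_mult (u z) (Q \<alpha> z) (e z)"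
    and de: "\<And>\<alpha> z. pullback_deriv u \<alpha> e z = a \<alpha> z *\<^sub>R J (u z) (e z)"
  shows "triad_equations Q a (\<lambda>z. (u z, e z, J (u z) (e z)))"
proof -
  have sJ: "smooth (\<lambda>z. J (u z) (e z))"
    unfolding J_def by (rule smooth_cross[OF sm])
  have frame: "eta (u z) \<bullet> u z = -1" "eta (u z) \<bullet> e z = 0" "eta (e z) \<bullet> e z = 1" for z
    using u[of z] e[of z] by (auto simp: hyperbolic_plane_iff tangent_plane_def hnorm_eq_1)
  have "e z \<bullet> eta (J (u z) (e z)) = 0" for z
    by (simp add: J_def dot_cross_self)
  moreover have "e z \<bullet> eta (e z) = 1" for z
    using frame(3)[of z] by (simp add: inner_commute)
  ultimately have "e z \<bullet> eta (partial \<alpha> u z) = Re (Q \<alpha> z)" for \<alpha> z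
    by (simp add: du frame_mult_def eta_simps inner_add_right)
  then have de': "partial \<alpha> e z = Re (Q \<alpha> z) *\<^sub>R u z + a \<alpha> z *\<^sub>R J (u z) (e z)" for \<alpha> z
    using de[of \<alpha> z] by (simp add: pullback_deriv_def algebra_simps)
  have "partial \<alpha> (\<lambda>z. J (u z) (e z)) z = Im (Q \<alpha> z) *\<^sub>R u z - a \<alpha> z *\<^sub>R e z" for \<alpha> z
    unfolding J_def
    using J_frame[OF frame, of z]
    by (simp add: partial_cross sm de' du frame_mult_def cross_eta_simps)
  then show ?thesis
    using de' du by (simp add: triad_equations_components sm sJ frame_mult_def)
qed

lemma triad_initial_dual:
  assumes "m \<in> hyperbolic_plane" "v\<^sub>0 \<in> tangent_plane m" "hnorm v\<^sub>0 = 1"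
  shows "(eta (cross3 (J m v\<^sub>0) v\<^sub>0), eta (cross3 (J m v\<^sub>0) m), eta (cross3 m v\<^sub>0)) = (m, v\<^sub>0, J m v\<^sub>0)"
proof -
  have "eta m \<bullet> m = -1" "eta m \<bullet> v\<^sub>0 = 0" "eta v\<^sub>0 \<bullet> v\<^sub>0 = 1"
    using assms by (auto simp: hyperbolic_plane_iff tangent_plane_def hnorm_eq_1)
  from J_frame[OF this] cross_skew[of "J m v\<^sub>0" m] show ?thesis
    by (simp add: eta_simps) (simp add: J_def)
qed

text \<open>Self-duality makes \<open>u\<close> orthogonal to \<open>e\<close> and \<open>f\<close> and gives \<open>\<langle>\<eta> e, e\<rangle> = - \<langle>\<eta> u, u\<rangle>\<close>, both being a triple product
  of \<open>u, e, f\<close> up to sign. The velocity of \<open>u\<close> is orthogonal to \<open>u\<close>, so \<open>\<langle>\<eta> u, u\<rangle>\<close> keeps its initial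
  value \<open>-1\<close>. Then the first component of \<open>u\<close> never vanishes, and by connectedness it stays positive.\<close>

lemma self_dual_triad_hyperbolic:
  assumes sm: "smooth u" "smooth e" "smooth f"
    and X: "triad_equations Q a (\<lambda>z. (u z, e z, f z))"
    and dual: "\<And>z. u z = eta (cross3 (f z) (e z))" "\<And>z. e z = eta (cross3 (f z) (u z))"
    and u0: "u 0 \<in> hyperbolic_plane"
  shows "u z \<in> hyperbolic_plane" "e z \<in> tangent_plane (u z)" "hnorm (e z) = 1"
proof -
  note X = X[unfolded triad_equations_components[OF sm], rule_format]
  have eta_u: "eta (u z) = cross3 (f z) (e z)" and eta_e: "eta (e z) = cross3 (f z) (u z)" for z
    by (subst dual, rule eta_eta)+
  have ue: "eta (u z) \<bullet> e z = 0" and uf: "eta (u z) \<bullet> f z = 0" for z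
    unfolding eta_u by (simp_all add: dot_cross_self)
  have su: "smooth (\<lambda>z. eta (u z) \<bullet> u z)"
    by (intro smooth_bilinear[OF bounded_bilinear_inner] smooth_bounded_linear[OF bounded_linear_eta] sm)
  have "partial \<alpha> (\<lambda>z. eta (u z) \<bullet> u z) z = 0" for \<alpha> z
  proof -
    have "partial \<alpha> (\<lambda>z. eta (u z) \<bullet> u z) z = eta (u z) \<bullet> partial \<alpha> u z + eta (partial \<alpha> u z) \<bullet> u z"
      by (simp add: partial_bilinear[OF bounded_bilinear_inner] sm partial_bounded_linear[OF bounded_linear_eta]
          smooth_bounded_linear[OF bounded_linear_eta])
    also have "\<dots> = 2 * (eta (u z) \<bullet> partial \<alpha> u z)"
      using eta_inner_commute[of "partial \<alpha> u z" "u z"] by (simp add: inner_commute)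
    also have "\<dots> = 0"
      by (simp add: X inner_add_right ue uf)
    finally show ?thesis .
  qed
  then have "deriv_along (\<lambda>z. eta (u z) \<bullet> u z) z v = 0" for z v
    by (simp add: deriv_along_eq_partial[OF su])
  then have "((\<lambda>z. eta (u z) \<bullet> u z) has_derivative (\<lambda>v. 0)) (at z)" for z
    using smooth_has_derivative[OF su, of z] by (metis (no_types, lifting) ext)
  then have "eta (u z) \<bullet> u z = eta (u 0) \<bullet> u 0" for z
    using has_derivative_zero_unique[of UNIV "\<lambda>z. eta (u z) \<bullet> u z"] by auto
  then have uu: "eta (u z) \<bullet> u z = -1" for z
    using u0 by (simp add: hyperbolic_plane_iff)
  show "e z \<in> tangent_plane (u z)"
    by (simp add: tangent_plane_def ue)
  have "eta (e z) \<bullet> e z = - (eta (u z) \<bullet> u z)"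
    unfolding eta_u eta_e
    using cross_triple[of "f z" "u z" "e z"] cross_triple[of "u z" "e z" "f z"] cross_skew[of "e z" "f z"]
    by simp
  then show "hnorm (e z) = 1"
    by (simp add: hnorm_eq_1 uu)
  have "u z $ 1 \<noteq> 0" for z
  proof
    assume "u z $ 1 = 0"
    then have "eta (u z) \<bullet> u z \<ge> 0"
      by (simp add: eta_def inner_vec_def sum_3)
    with uu show False by simp
  qed
  moreover have "u 0 $ 1 > 0"
    using u0 by (simp add: hyperbolic_plane_def)
  moreover have "connected (range (\<lambda>z. u z $ 1))"
    using sm(1) times_differentiable_continuous[of 0 u]
    by (intro connected_continuous_image continuous_intros) (auto simp: smooth_def connected_UNIV)
  ultimately have "u z $ 1 > 0"
    using connectedD_interval[of "range (\<lambda>z. u z $ 1)" "u z $ 1" "u 0 $ 1" 0]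
    by (force simp: not_less)
  with uu show "u z \<in> hyperbolic_plane"
    by (simp add: hyperbolic_plane_iff)
qed

text \<open>\<open>\<eta>(u \<times> \<partial>\<^sub>\<ell> u) = J \<partial>\<^sub>\<ell> u = (\<i> q\<^sub>\<ell>) \<cdot> e\<close>. Its \<open>\<partial>\<^sub>\<ell>\<close>-derivative has the tangential part \<open>(\<i> D\<^sub>\<ell> q\<^sub>\<ell>) \<cdot> e\<close>, and its
  normal part \<open>Re (\<i> q\<^sub>\<ell>) Re q\<^sub>\<ell> + Im (\<i> q\<^sub>\<ell>) Im q\<^sub>\<ell>\<close> is zero.\<close>

lemma frame_schroedinger:
  assumes sm: "smooth u" "smooth e" "smooth f" "\<And>\<alpha>. smooth (Q \<alpha>)"
    and X: "triad_equations Q a (\<lambda>z. (u z, e z, f z))"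
    and dual: "\<And>z. e z = eta (cross3 (f z) (u z))" "\<And>z. f z = eta (cross3 (u z) (e z))"
    and Q0: "\<And>z. Q None z = \<i> * (\<Sum>l\<in>UNIV. gauge_deriv a (Some l) (Q (Some l)) z)"
  shows "partial None u z =
    eta (\<Sum>l\<in>UNIV. partial (Some l) (\<lambda>y. cross3 (u y) (partial (Some l) u y)) z)"
proof -
  note X = X[unfolded triad_equations_components[OF sm(1-3)], rule_format]
  have s: "smooth (\<lambda>z. Re (Q \<alpha> z))" "smooth (\<lambda>z. Im (Q \<alpha> z))" for \<alpha>
    using sm(4) by (auto intro: smooth_bounded_linear[OF bounded_linear_Re] smooth_bounded_linear[OF bounded_linear_Im])
  have s': "smooth (\<lambda>z. Re (Q \<alpha> z) *\<^sub>R f z)" "smooth (\<lambda>z. (- Im (Q \<alpha> z)) *\<^sub>R e z)" for \<alpha>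
    using sm s by (auto intro!: smooth_bilinear[OF bounded_bilinear_scaleR]
        smooth_bounded_linear[OF bounded_linear_minus[OF bounded_linear_ident]])
  let ?D = "\<lambda>l. gauge_deriv a (Some l) (Q (Some l)) z"
  have "eta (partial (Some l) (\<lambda>y. cross3 (u y) (partial (Some l) u y)) z) =
      (- Im (?D l)) *\<^sub>R e z + Re (?D l) *\<^sub>R f z" for l
  proof -
    let ?q = "Q (Some l)"
    have "cross3 (u y) (f y) = - eta (e y)" "cross3 (u y) (e y) = eta (f y)" for y
      using arg_cong[OF dual(1)[of y], of eta] arg_cong[OF dual(2)[of y], of eta]
        cross_skew[of "u y" "f y"] by simp_all
    then have "(\<lambda>y. cross3 (u y) (partial (Some l) u y)) =
        (\<lambda>y. eta (Re (?q y) *\<^sub>R f y + (- Im (?q y)) *\<^sub>R e y))"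
      by (simp add: X cross_eta_simps)
    then have "eta (partial (Some l) (\<lambda>y. cross3 (u y) (partial (Some l) u y)) z) =
        partial (Some l) (\<lambda>y. Re (?q y) *\<^sub>R f y + (- Im (?q y)) *\<^sub>R e y) z"
      by (simp only: partial_bounded_linear[OF bounded_linear_eta smooth_add[OF s']] eta_eta)
    also have "\<dots> = Re (?q z) *\<^sub>R partial (Some l) f z + Re (partial (Some l) ?q z) *\<^sub>R f z +
        ((- Im (?q z)) *\<^sub>R partial (Some l) e z + (- Im (partial (Some l) ?q z)) *\<^sub>R e z)"
      using sm s smooth_bounded_linear[OF bounded_linear_minus[OF bounded_linear_ident] s(2)]
      by (simp only: partial_add[OF s'] partial_bilinear[OF bounded_bilinear_scaleR]
          partial_bounded_linear[OF bounded_linear_minus[OF bounded_linear_ident]]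
          partial_bounded_linear[OF bounded_linear_Re] partial_bounded_linear[OF bounded_linear_Im])
    also have "\<dots> = (- Im (?D l)) *\<^sub>R e z + Re (?D l) *\<^sub>R f z"
      by (simp add: X gauge_deriv_def algebra_simps)
    finally show ?thesis .
  qed
  then show ?thesis
    by (simp add: X Q0 linear_sum[OF eta_linear] sum_subtractf scaleR_sum_left)
qed

theorem proposition4p1:
  fixes q :: "'d::finite \<Rightarrow> 'd spacetime \<Rightarrow> complex"
    and a :: "'d option \<Rightarrow> 'd spacetime \<Rightarrow> real"
    and m v\<^sub>0 :: "real^3"
  assumes smooth_q: "\<And>l. smooth (q l)"
    and smooth_a: "\<And>\<alpha>. smooth (a \<alpha>)"
    and evolution: "\<And>l z. gauge_deriv a None (q l) z =
        \<i> * (\<Sum>k\<in>UNIV. gauge_deriv a (Some k) (gauge_deriv a (Some k) (q l)) z)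
        + (\<Sum>k\<in>UNIV. of_real (q l z \<bullet> (\<i> * q k z)) * q k z)"
    and compatibility: "\<And>l k z. gauge_deriv a (Some l) (q k) z = gauge_deriv a (Some k) (q l) z"
    and curvature: "\<And>l j z. partial (Some l) (a (Some j)) z - partial (Some j) (a (Some l)) z
        = - (q l z \<bullet> (\<i> * q j z))"
    and curvature_time: "\<And>l z. partial (Some l) (a None) z - partial None (a (Some l)) z
        = - (q l z \<bullet> (\<i> * with_time a q None z))"
    and coulomb: "\<And>z. (\<Sum>k\<in>UNIV. partial (Some k) (a (Some k)) z) = 0"
    and m: "m \<in> hyperbolic_plane"
    and v\<^sub>0: "v\<^sub>0 \<in> tangent_plane m" "hnorm v\<^sub>0 = 1"
  shows "\<exists>!(u, e). schroedinger_map u \<and> frame_along u e \<and> u (0, 0) = m \<and> e (0, 0) = v\<^sub>0 \<and>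
      (\<forall>\<alpha> z. partial \<alpha> u z = frame_mult (u z) (with_time a q \<alpha> z) (e z)) \<and>
      (\<forall>\<alpha> z. pullback_deriv u \<alpha> e z = a \<alpha> z *\<^sub>R J (u z) (e z))"
proof -
  define Q where "Q = with_time a q"
  have Q_Some: "Q (Some l) = q l" for l
    by (simp add: Q_def with_time_def)
  have Q0: "Q None z = \<i> * (\<Sum>l\<in>UNIV. gauge_deriv a (Some l) (Q (Some l)) z)" for z
    by (simp add: Q_def with_time_def)
  have sQ: "smooth (Q \<alpha>)" for \<alpha>
    unfolding Q_def by (rule smooth_with_time[OF smooth_q smooth_a])
  have time: "gauge_deriv a None (Q (Some l)) z = gauge_deriv a (Some l) (Q None) z" for l z
    unfolding Q_Some unfolding Q_def
    by (rule time_compatibility[OF smooth_q smooth_a evolution compatibility curvature])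
  have compat: "gauge_deriv a \<alpha> (Q \<beta>) z = gauge_deriv a \<beta> (Q \<alpha>) z" for \<alpha> \<beta> z
    by (cases \<alpha>; cases \<beta>) (simp_all add: time[unfolded Q_Some] Q_Some compatibility)
  have inner_skew: "- (x \<bullet> (\<i> * y)) = y \<bullet> (\<i> * x)" for x y :: complex
    by (simp add: inner_complex_def)
  have curv: "partial \<alpha> (a \<beta>) z - partial \<beta> (a \<alpha>) z = - (Q \<alpha> z \<bullet> (\<i> * Q \<beta> z))" for \<alpha> \<beta> z
  proof (cases \<alpha>; cases \<beta>)
    fix l assume "\<alpha> = None" "\<beta> = Some l"
    then show ?thesis
      using curvature_time[of l z] inner_skew[of "q l z" "Q None z"] by (simp add: Q_Some flip: Q_def)
  qed (use inner_skew curvature curvature_time in \<open>simp_all add: Q_Some inner_complex_def flip: Q_def\<close>)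
  interpret flat_connection "triad_connection Q a"
    by (rule flat_triad_connection[OF sQ smooth_a compat curv])
  note equations_iff = triad_equations_iff_parallel[of Q a, OF sQ smooth_a]
  let ?sol = "\<lambda>(u, e). schroedinger_map u \<and> frame_along u e \<and> u (0, 0) = m \<and> e (0, 0) = v\<^sub>0 \<and>
      (\<forall>\<alpha> z. partial \<alpha> u z = frame_mult (u z) (Q \<alpha> z) (e z)) \<and>
      (\<forall>\<alpha> z. pullback_deriv u \<alpha> e z = a \<alpha> z *\<^sub>R J (u z) (e z))"
  obtain X where "parallel X" and X0: "X 0 = (m, v\<^sub>0, J m v\<^sub>0)"
    by (rule parallel_exists)
  define u e f where "u z = fst (X z)" and "e z = fst (snd (X z))" and "f z = snd (snd (X z))" for z
  have X_def: "X = (\<lambda>z. (u z, e z, f z))"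
    by (simp add: u_def e_def f_def)
  have X: "triad_equations Q a (\<lambda>z. (u z, e z, f z))"
    using \<open>parallel X\<close> unfolding equations_iff[symmetric] X_def .
  have "smooth X"
    using X unfolding X_def triad_equations_def by blast
  note smooth_snd = smooth_bounded_linear[OF bounded_linear_snd this]
  have sm: "smooth u" "smooth e" "smooth f"
    unfolding u_def e_def f_def
    by (rule smooth_bounded_linear[OF bounded_linear_fst \<open>smooth X\<close>]
        smooth_bounded_linear[OF bounded_linear_fst smooth_snd]
        smooth_bounded_linear[OF bounded_linear_snd smooth_snd])+
  have "(u z, e z, f z) = (eta (cross3 (f z) (e z)), eta (cross3 (f z) (u z)), eta (cross3 (u z) (e z)))" for z
  proof (rule parallel_unique)
    show "parallel (\<lambda>z. (u z, e z, f z))"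
      "parallel (\<lambda>z. (eta (cross3 (f z) (e z)), eta (cross3 (f z) (u z)), eta (cross3 (u z) (e z))))"
      using X triad_equations_dual[OF sm X] unfolding equations_iff by auto
    show "(u 0, e 0, f 0) = (eta (cross3 (f 0) (e 0)), eta (cross3 (f 0) (u 0)), eta (cross3 (u 0) (e 0)))"
      using triad_initial_dual[OF m v\<^sub>0] X0 by (simp add: u_def e_def f_def)
  qed
  then have dual: "u z = eta (cross3 (f z) (e z))" "e z = eta (cross3 (f z) (u z))"
      "f z = eta (cross3 (u z) (e z))" for z
    unfolding prod.inject by blast+
  have f_J: "f z = J (u z) (e z)" for z
    using dual(3) by (simp add: J_def)
  have "u 0 \<in> hyperbolic_plane"
    using m X0 by (simp add: u_def)
  note geo = self_dual_triad_hyperbolic[OF sm X dual(1,2) this]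
  have comps: "partial \<alpha> u z = Re (Q \<alpha> z) *\<^sub>R e z + Im (Q \<alpha> z) *\<^sub>R f z"
      "partial \<alpha> e z = Re (Q \<alpha> z) *\<^sub>R u z + a \<alpha> z *\<^sub>R f z" for \<alpha> z
    using X unfolding triad_equations_components[OF sm] by blast+
  have "schroedinger_map u"
    unfolding schroedinger_map_def
    using frame_schroedinger[OF sm sQ X dual(2,3) Q0] geo(1) sm(1) by blast
  moreover have "frame_along u e"
    using geo(2,3) sm(2) by (simp add: frame_along_def)
  moreover have "u (0, 0) = m" "e (0, 0) = v\<^sub>0"
    using X0 by (simp_all add: u_def e_def flip: zero_prod_def)
  moreover have "partial \<alpha> u z = frame_mult (u z) (Q \<alpha> z) (e z)" for \<alpha> z
    by (simp add: comps frame_mult_def f_J)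
  moreover have "pullback_deriv u \<alpha> e z = a \<alpha> z *\<^sub>R J (u z) (e z)" for \<alpha> z
  proof -
    have "e z \<bullet> eta (e z) = 1"
      using geo(3)[of z] by (simp add: hnorm_eq_1 inner_commute)
    moreover have "e z \<bullet> eta (f z) = 0"
      by (subst dual(3)) (simp add: dot_cross_self)
    ultimately show ?thesis
      by (simp add: pullback_deriv_def comps eta_simps inner_add_right f_J)
  qed
  ultimately have exists: "?sol (u, e)"
    by simp
  have unique: "(u', e') = (u, e)" if sol: "?sol (u', e')" for u' e'
  proof -
    have "triad_equations Q a (\<lambda>z. (u' z, e' z, J (u' z) (e' z)))"
      by (rule frame_triad_equations)
        (use sol in \<open>unfold prod.case schroedinger_map_def frame_along_def, blast\<close>)+
    then have "parallel (\<lambda>z. (u' z, e' z, J (u' z) (e' z)))"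
      by (simp only: equations_iff)
    moreover have "(u' 0, e' 0, J (u' 0) (e' 0)) = X 0"
      using sol unfolding prod.case zero_prod_def[symmetric] X0 by blast
    ultimately have "(u' z, e' z, J (u' z) (e' z)) = (u z, e z, f z)" for z
      using parallel_unique[OF _ \<open>parallel X\<close>, of "\<lambda>z. (u' z, e' z, J (u' z) (e' z))" z]
      by (simp only: X_def)
    then have "u' z = u z" "e' z = e z" for z
      unfolding prod.inject by blast+
    then show ?thesis by blast
  qed
  have "\<exists>!p. ?sol p"
  proof (rule ex1I[of ?sol, OF exists])
    fix p assume "?sol p"
    with unique[of "fst p" "snd p"] show "p = (u, e)"
      unfolding prod.collapse .
  qed
  then show ?thesis
    unfolding Q_def .
qed

end
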